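(* Let $(X_t)_{t\ge0}$ be a Markov chain on $\mathcal{X}$ with transition kernel $P$. Assume that $(X_t)$ is reversible with respect to the probability measure $\pi$ and that it has nonnegative eigenvalues. Also assume that $(X_t)$ has a drift function with respect to a small set $C\subset\mathcal{X}$. Let $V$, $0<\lambda<1$, $K<\infty$ be the data associated with the drift function, and let $\nu$, $m\ge1$, $\varepsilon>0$ be the data associated with the small set. Then \[ \|P^t(x,\cdot)-\pi\|_{\mathrm{TV}}\le F(x,t)\,\rho^t\qquad\text{for all } x\in\mathcal{X} \text{ and integers } t\ge0, \] where $\rho<1$ and $F(x,t)$ are defined as follows. Let \[ B=\frac{1-\lambda^m}{1-\lambda}(K-\lambda)+\lambda^m . \] If $\varepsilon=1$, set $\rho=\lambda$ and $r=1$. If $\varepsilon<1$, set \[ \rho=\max\left\{\lambda,\ \exp\left(\frac{-\log(1-\varepsilon)\log\lambda}{-m\log\lambda+\log(B-\varepsilon)-\log(1-\varepsilon)}\right)\right\},\qquad r=\frac{\log\rho}{\log\lambda}. \] Set \[ A(\nu)=\left[\frac{B-(1-\varepsilon)}{\varepsilon}\right]^r\rho^{1-m},\qquad A(x)=V(x)^r\rho^{1-m},\qquad D=\frac12\sqrt{\frac{A(\nu)\rho}{1-\rho}}, \] \[ F(x,t)=\frac{1-\rho}{\rho}\,D\,A(x)\,t+(1-D)_+A(x)+D . \]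
   Context: $\mathcal{X}$ is a general (measurable) state space; all subsets and functions considered are measurable. Notation: $Pf(x)=\int f(y)P(x,dy)$; $P^t(x,\cdot)$ is the law of the chain started from $x$ after $t$ steps; $r_+=\max(r,0)$ for $r\in\mathbb{R}$. Total variation distance: $\|\mu-\mu'\|_{\mathrm{TV}}=\sup_{S\subset\mathcal{X}}|\mu(S)-\mu'(S)|$ for probability measures $\mu,\mu'$. Reversibility: $(X_t)$ is reversible with respect to $\pi$ if $\pi(dx)P(x,dy)=\pi(dy)P(y,dx)$ as measures on $\mathcal{X}\times\mathcal{X}$; equivalently $f\mapsto Pf$ is a self-adjoint operator on the space $L^2(\pi)$ of real-valued functions. Its spectrum is then contained in $[-1,1]$; the chain has nonnegative eigenvalues if the $L^2(\pi)$ spectrum of $P$ is contained in $[0,1]$. Drift function: a function $V:\mathcal{X}\to[1,\infty)$ together with constants $\lambda$ ($0<\lambda<1$) and $K<\infty$ such that $PV(x)\le\lambda V(x)$ for $x\notin C$ and $PV(x)\le K$ for $x\in C$ is a drift function for $(X_t)$ with respect to $C$. Small set: $C\subset\mathcal{X}$ is a small set if there are an integer $m\ge1$, a constant $\varepsilon>0$ and a probability measure $\nu$ on $\mathcal{X}$ such that $P^m(x,S)\ge\varepsilon\nu(S)$ for all $x\in C$ and $S\subset\mathcal{X}$. *)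

theory Defs
  imports "HOL-Probability.Probability"
begin

definition markov_kernel :: "'a measure \<Rightarrow> ('a \<Rightarrow> 'a measure) \<Rightarrow> bool" where
  "markov_kernel M P \<longleftrightarrow> P \<in> M \<rightarrow>\<^sub>M prob_algebra M"

primrec kernel_power :: "'a measure \<Rightarrow> ('a \<Rightarrow> 'a measure) \<Rightarrow> nat \<Rightarrow> 'a \<Rightarrow> 'a measure" where
  "kernel_power M P 0 x = return M x"
| "kernel_power M P (Suc t) x = kernel_power M P t x \<bind> P"

definition tv_dist :: "'a measure \<Rightarrow> 'a measure \<Rightarrow> 'a measure \<Rightarrow> real" where
  "tv_dist M \<mu> \<mu>' = (\<Squnion>S\<in>sets M. \<bar>measure \<mu> S - measure \<mu>' S\<bar>)"

text \<open>The measure \<open>\<pi>(dx) P(x,dy)\<close> on the product space.\<close>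

definition joint_law :: "'a measure \<Rightarrow> 'a measure \<Rightarrow> ('a \<Rightarrow> 'a measure) \<Rightarrow> ('a \<times> 'a) measure" where
  "joint_law M \<pi> P = \<pi> \<bind> (\<lambda>x. P x \<bind> (\<lambda>y. return (M \<Otimes>\<^sub>M M) (x, y)))"

text \<open>The right-hand side is \<open>\<pi>(dy) P(y,dx)\<close>, i.e. the image of \<open>\<pi>(dx) P(x,dy)\<close>
  under exchanging the coordinates.\<close>

definition reversible :: "'a measure \<Rightarrow> 'a measure \<Rightarrow> ('a \<Rightarrow> 'a measure) \<Rightarrow> bool" where
  "reversible M \<pi> P \<longleftrightarrow>
     joint_law M \<pi> P = distr (joint_law M \<pi> P) (M \<Otimes>\<^sub>M M) (\<lambda>(x, y). (y, x))"

text \<open>Real \<open>L\<^sup>2(\<pi>)\<close> is represented by square-integrable functions, two of which denote the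
  same vector iff they agree almost everywhere.\<close>

definition L2_funs :: "'a measure \<Rightarrow> ('a \<Rightarrow> real) set" where
  "L2_funs \<pi> = {f \<in> borel_measurable \<pi>. integrable \<pi> (\<lambda>x. (f x)\<^sup>2)}"

definition L2_norm :: "'a measure \<Rightarrow> ('a \<Rightarrow> real) \<Rightarrow> real" where
  "L2_norm \<pi> f = sqrt (\<integral>x. (f x)\<^sup>2 \<partial>\<pi>)"

text \<open>If \<open>\<pi>\<close> is stationary and \<open>f\<close> is in \<open>L\<^sup>2(\<pi>)\<close>, then \<open>f\<close> is \<open>P x\<close>-integrable for
  \<open>\<pi>\<close>-almost every \<open>x\<close>; the value \<open>0\<close> that the Bochner integral takes at the other points
  does not affect the class of \<open>Pf\<close>.\<close>

definition kernel_op :: "('a \<Rightarrow> 'a measure) \<Rightarrow> ('a \<Rightarrow> real) \<Rightarrow> 'a \<Rightarrow> real" where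
  "kernel_op P f = (\<lambda>x. \<integral>y. f y \<partial>P x)"

text \<open>\<open>L2_inverse \<pi> T R\<close>: \<open>R\<close> induces a bounded two-sided inverse of \<open>T\<close> on \<open>L\<^sup>2(\<pi>)\<close>.
  For an operator \<open>T\<close> that is linear and bounded on \<open>L\<^sup>2(\<pi>)\<close>, the conditions force \<open>R\<close> to
  respect almost-everywhere equality and to be linear modulo it.\<close>

definition L2_inverse ::
    "'a measure \<Rightarrow> (('a \<Rightarrow> real) \<Rightarrow> 'a \<Rightarrow> real) \<Rightarrow> (('a \<Rightarrow> real) \<Rightarrow> 'a \<Rightarrow> real) \<Rightarrow> bool" where
  "L2_inverse \<pi> T R \<longleftrightarrow>
     (\<forall>f\<in>L2_funs \<pi>. R f \<in> L2_funs \<pi>) \<and>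
     (\<exists>c. \<forall>f\<in>L2_funs \<pi>. L2_norm \<pi> (R f) \<le> c * L2_norm \<pi> f) \<and>
     (\<forall>f\<in>L2_funs \<pi>. AE x in \<pi>. R (T f) x = f x) \<and>
     (\<forall>f\<in>L2_funs \<pi>. AE x in \<pi>. T (R f) x = f x)"

text \<open>Real spectral values only: for a self-adjoint operator these are the whole spectrum.\<close>

definition L2_spectrum :: "'a measure \<Rightarrow> (('a \<Rightarrow> real) \<Rightarrow> 'a \<Rightarrow> real) \<Rightarrow> real set" where
  "L2_spectrum \<pi> T = {z. \<nexists>R. L2_inverse \<pi> (\<lambda>f x. T f x - z * f x) R}"

definition nonneg_eigenvalues :: "'a measure \<Rightarrow> ('a \<Rightarrow> 'a measure) \<Rightarrow> bool" where
  "nonneg_eigenvalues \<pi> P \<longleftrightarrow> L2_spectrum \<pi> (kernel_op P) \<subseteq> {0..1}"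

text \<open>\<open>PV\<close> is a nonnegative integral here: the Bochner integral would be \<open>0\<close>, and the bounds
  vacuous, where \<open>PV(x) = \<infinity>\<close>.\<close>

definition drift_function ::
    "'a measure \<Rightarrow> ('a \<Rightarrow> 'a measure) \<Rightarrow> 'a set \<Rightarrow> ('a \<Rightarrow> real) \<Rightarrow> real \<Rightarrow> real \<Rightarrow> bool" where
  "drift_function M P C V l K \<longleftrightarrow>
     V \<in> borel_measurable M \<and> (\<forall>x\<in>space M. 1 \<le> V x) \<and> 0 < l \<and> l < 1 \<and>
     (\<forall>x\<in>space M - C. (\<integral>\<^sup>+y. ennreal (V y) \<partial>P x) \<le> ennreal (l * V x)) \<and>
     (\<forall>x\<in>C. (\<integral>\<^sup>+y. ennreal (V y) \<partial>P x) \<le> ennreal K)"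

definition small_set ::
    "'a measure \<Rightarrow> ('a \<Rightarrow> 'a measure) \<Rightarrow> 'a set \<Rightarrow> nat \<Rightarrow> real \<Rightarrow> 'a measure \<Rightarrow> bool" where
  "small_set M P C m \<epsilon> \<nu> \<longleftrightarrow>
     C \<in> sets M \<and> 1 \<le> m \<and> 0 < \<epsilon> \<and> \<nu> \<in> space (prob_algebra M) \<and>
     (\<forall>x\<in>C. \<forall>S\<in>sets M. \<epsilon> * measure \<nu> S \<le> measure (kernel_power M P m x) S)"

end

theory Submission
  imports Defs "HOL-Computational_Algebra.Formal_Power_Series"
begin

text \<open>
  Whenever the chain is in \<open>C\<close>, let it make \<open>m\<close> steps at once; by minorization it can be
  arranged that with probability \<open>\<epsilon>\<close>, independently of the past, the state reached after these
  steps is drawn from \<open>\<nu>\<close>. Let \<open>\<tau>\<close> be the first time at which this happens. Splitting at \<open>\<tau>\<close>,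
  \<open>P\<^sup>t(x,\<cdot>) = (\<Sum>k\<le>t. Pr\<^sub>x(\<tau> = k) \<nu>P\<^sup>t\<^sup>-\<^sup>k) + Pr\<^sub>x(X\<^sub>t \<in> \<cdot>, \<tau> > t)\<close>, which is
  \<open>renewal_decomposition\<close>. The quantities \<open>Pr\<^sub>x(\<tau> = n)\<close> and \<open>E\<^sub>x[f(X\<^sub>n); \<tau> > n]\<close> are
  introduced through their recursion over the first step or block of steps. The theorem follows
  from this identity and two estimates.

  \<^bold>\<open>The tail of \<open>\<tau>\<close>.\<close> Choose \<open>r\<close> with \<open>\<rho> = l\<^sup>r\<close>. Outside \<open>C\<close>, concavity of \<open>v \<mapsto> v\<^sup>r\<close> turns the drift
  condition into \<open>P(V\<^sup>r) \<le> \<rho> V\<^sup>r\<close>. The definition of \<open>\<rho>\<close> is precisely what makes the part of a block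
  that does not regenerate contract \<open>V\<^sup>r\<close> by \<open>\<rho>\<^sup>m\<close>. Hence \<open>Pr\<^sub>x(\<tau> > n) \<le> A(x) \<rho>\<^sup>n\<close>, and likewise
  for the initial law \<open>\<nu>\<close> with the constant \<open>A(\<nu>)\<close> (\<open>surv_one_le_drift\<close>,
  \<open>integral_surv_one_le_drift\<close>).

  \<^bold>\<open>The chain started from \<open>\<nu>\<close>.\<close> The occupation measure of a cycle between regenerations is
  \<open>E\<^sub>\<nu> \<tau>\<close> times \<open>\<pi>\<close> (\<open>cycle_formula\<close>); its term at time \<open>0\<close> is \<open>\<nu>\<close>, so \<open>\<nu>\<close> has a density with respect to
  \<open>\<pi>\<close> that is at most \<open>E\<^sub>\<nu> \<tau>\<close>. Let \<open>h\<close> be this density minus \<open>1\<close>. By reversibility \<open>\<nu>P\<^sup>n\<close> has the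
  density \<open>1 + P\<^sup>n h\<close>, so it suffices to bound the \<open>L\<^sup>2\<close>-norm of \<open>P\<^sup>n h\<close>, whose square is \<open>w(2n)\<close> with
  \<open>w(n) = \<langle>h, P\<^sup>n h\<rangle>\<close>. Summing the renewal equation for \<open>w\<close> gives
  \<open>(\<Sum>k\<le>n. Pr\<^sub>\<nu>(\<tau> > k) w(n - k)) = (\<Sum>k\<le>n. E\<^sub>\<nu>[h(X\<^sub>k); \<tau> > k])\<close>.
  The right-hand side is a geometrically small remainder because the complete series is
  \<open>E\<^sub>\<nu> \<tau> \<cdot> \<pi>(h) = 0\<close>. Nonnegative eigenvalues make \<open>P\<close> positive semidefinite
  (\<open>inner_prod_T_nonneg\<close>), so all terms on the left are nonnegative and \<open>w(n) \<le> c \<rho>\<^sup>n\<close> for some \<open>c\<close>.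
  The Cauchy-Schwarz inequality \<open>w(n)\<^sup>2 \<le> w(0) w(2n)\<close> improves \<open>c\<close> to \<open>w(0)\<close>, and
  \<open>w(0) \<le> E\<^sub>\<nu> \<tau> - 1 \<le> A(\<nu>) \<rho> / (1 - \<rho>) = 4 D\<^sup>2\<close>. This gives the distance \<open>D \<rho>\<^sup>n\<close> between \<open>\<nu>P\<^sup>n\<close> and \<open>\<pi>\<close>
  (\<open>convergence_from_\<nu>\<close>).

  Inserting both estimates into the decomposition and summing by parts gives \<open>F(x,t) \<rho>\<^sup>t\<close>
  (\<open>convergence_rate\<close>).
\<close>

section \<open>Integrals of bounded measurable functions\<close>

text \<open>A Markov kernel maps this space into itself and every probability measure integrates it. The
  density of \<open>\<nu>\<close> with respect to \<open>\<pi>\<close> turns out to belong to it, so that the \<open>L\<^sup>2\<close> estimates can be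
  carried out on honest functions instead of classes modulo null sets.\<close>
definition bounded_measurable :: "'a measure \<Rightarrow> ('a \<Rightarrow> real) set" where
  "bounded_measurable M = {f \<in> borel_measurable M. \<exists>c. \<forall>x\<in>space M. \<bar>f x\<bar> \<le> c}"

lemma bounded_measurableI:
  assumes "f \<in> borel_measurable M" "\<And>x. x \<in> space M \<Longrightarrow> \<bar>f x\<bar> \<le> c"
  shows "f \<in> bounded_measurable M"
  using assms unfolding bounded_measurable_def by blast

lemma bounded_measurable_measurable [measurable_dest]:
  "f \<in> bounded_measurable M \<Longrightarrow> f \<in> borel_measurable M"
  by (simp add: bounded_measurable_def)

lemma bounded_measurable_bound:
  "f \<in> bounded_measurable M \<Longrightarrow> \<exists>c\<ge>0. \<forall>x\<in>space M. \<bar>f x\<bar> \<le> c"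
proof -
  assume "f \<in> bounded_measurable M"
  then obtain c where c: "\<forall>x\<in>space M. \<bar>f x\<bar> \<le> c"
    by (auto simp: bounded_measurable_def)
  then have "\<forall>x\<in>space M. \<bar>f x\<bar> \<le> \<bar>c\<bar>" by force
  then show ?thesis using abs_ge_zero by blast
qed

lemma bounded_measurable_cong:
  assumes "\<And>x. x \<in> space M \<Longrightarrow> f x = g x"
  shows "f \<in> bounded_measurable M \<longleftrightarrow> g \<in> bounded_measurable M"
  using measurable_cong[of M f g borel] assms by (simp add: bounded_measurable_def)

lemma bounded_measurable_const [simp]: "(\<lambda>x. c) \<in> bounded_measurable M"
  by (rule bounded_measurableI[of _ _ "\<bar>c\<bar>"]) auto

lemma bounded_measurable_indicator [simp]:
  "S \<in> sets M \<Longrightarrow> indicator S \<in> bounded_measurable M"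
  by (rule bounded_measurableI[of _ _ 1]) (auto simp: indicator_def)

lemma bounded_measurable_add [simp]:
  assumes "f \<in> bounded_measurable M" "g \<in> bounded_measurable M"
  shows "(\<lambda>x. f x + g x) \<in> bounded_measurable M"
proof -
  obtain c d where c: "\<forall>x\<in>space M. \<bar>f x\<bar> \<le> c" and d: "\<forall>x\<in>space M. \<bar>g x\<bar> \<le> d"
    using assms[THEN bounded_measurable_bound] by blast
  show ?thesis
  proof (rule bounded_measurableI[of _ _ "c + d"])
    show "\<bar>f x + g x\<bar> \<le> c + d" if "x \<in> space M" for x
      using c d that abs_triangle_ineq[of "f x" "g x"] by fastforce
    show "(\<lambda>x. f x + g x) \<in> borel_measurable M"
      using assms by measurable
  qed
qed

lemma bounded_measurable_mult [simp]:
  assumes "f \<in> bounded_measurable M" "g \<in> bounded_measurable M"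
  shows "(\<lambda>x. f x * g x) \<in> bounded_measurable M"
proof -
  obtain c d where "0 \<le> c" "0 \<le> d"
      "\<forall>x\<in>space M. \<bar>f x\<bar> \<le> c" "\<forall>x\<in>space M. \<bar>g x\<bar> \<le> d"
    using assms[THEN bounded_measurable_bound] by blast
  then show ?thesis
    using assms by (intro bounded_measurableI[of _ _ "c * d"] borel_measurable_times)
      (auto simp: abs_mult bounded_measurable_measurable intro!: mult_mono)
qed

lemma bounded_measurable_diff [simp]:
  assumes "f \<in> bounded_measurable M" "g \<in> bounded_measurable M"
  shows "(\<lambda>x. f x - g x) \<in> bounded_measurable M"
  using bounded_measurable_add[OF assms(1)
      bounded_measurable_mult[OF bounded_measurable_const[of "-1"] assms(2)]] by simp

lemma space_of_prob_algebra: "\<mu> \<in> space (prob_algebra M) \<Longrightarrow> space \<mu> = space M"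
  by (rule sets_eq_imp_space_eq) (simp add: space_prob_algebra)

lemma sets_of_prob_algebra: "\<mu> \<in> space (prob_algebra M) \<Longrightarrow> sets \<mu> = sets M"
  by (simp add: space_prob_algebra)

lemma measurable_of_prob_algebra:
  assumes "\<mu> \<in> space (prob_algebra M)" "f \<in> M \<rightarrow>\<^sub>M N"
  shows "f \<in> \<mu> \<rightarrow>\<^sub>M N"
proof -
  have "\<mu> \<rightarrow>\<^sub>M N = M \<rightarrow>\<^sub>M N"
    by (rule measurable_cong_sets[OF sets_of_prob_algebra[OF assms(1)] refl])
  then show ?thesis using assms(2) by simp
qed

lemma integrable_bounded_measurable [simp]:
  assumes "\<mu> \<in> space (prob_algebra M)" "f \<in> bounded_measurable M"
  shows "integrable \<mu> (f :: 'a \<Rightarrow> real)"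
proof -
  interpret prob_space \<mu> using assms(1) by (simp add: space_prob_algebra)
  obtain c where c: "\<forall>x\<in>space M. \<bar>f x\<bar> \<le> c"
    using bounded_measurable_bound[OF assms(2)] by blast
  show ?thesis
  proof (rule integrable_const_bound)
    show "AE x in \<mu>. norm (f x) \<le> c"
      using c by (intro AE_I2) (metis real_norm_def space_of_prob_algebra[OF assms(1)])
    show "f \<in> borel_measurable \<mu>"
      by (rule measurable_of_prob_algebra[OF assms(1) bounded_measurable_measurable[OF assms(2)]])
  qed
qed

lemma integral_const_prob_algebra [simp]:
  "\<mu> \<in> space (prob_algebra M) \<Longrightarrow> (\<integral>x. c \<partial>\<mu>) = (c::real)"
  by (simp add: space_prob_algebra prob_space.prob_space)

lemma measure_space_prob_algebra [simp]:
  "\<mu> \<in> space (prob_algebra M) \<Longrightarrow> measure \<mu> (space \<mu>) = 1"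
  by (simp add: space_prob_algebra prob_space.prob_space)

lemma integral_mono_bounded_measurable:
  assumes "\<mu> \<in> space (prob_algebra M)" "f \<in> bounded_measurable M" "g \<in> bounded_measurable M"
    and "\<And>x. x \<in> space M \<Longrightarrow> f x \<le> (g x :: real)"
  shows "(\<integral>x. f x \<partial>\<mu>) \<le> (\<integral>x. g x \<partial>\<mu>)"
  using assms by (intro integral_mono) (auto simp: space_of_prob_algebra[OF assms(1)])

lemma integral_bounded_measurable_nonneg:
  assumes "\<mu> \<in> space (prob_algebra M)" "\<And>x. x \<in> space M \<Longrightarrow> 0 \<le> (f x :: real)"
  shows "0 \<le> (\<integral>x. f x \<partial>\<mu>)"
  using assms by (intro integral_nonneg_AE AE_I2) (auto simp: space_of_prob_algebra[OF assms(1)])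

lemma abs_integral_le_bounded_measurable:
  assumes "\<mu> \<in> space (prob_algebra M)" "f \<in> bounded_measurable M"
    and "\<And>x. x \<in> space M \<Longrightarrow> \<bar>f x\<bar> \<le> c"
  shows "\<bar>\<integral>x. f x \<partial>\<mu>\<bar> \<le> c"
proof -
  have f: "f x \<le> c" "- c \<le> f x" if "x \<in> space M" for x
    using assms(3)[OF that] by auto
  show ?thesis
    using integral_mono_bounded_measurable[OF assms(1,2) bounded_measurable_const[of c] f(1)]
      integral_mono_bounded_measurable[OF assms(1) bounded_measurable_const[of "- c"] assms(2) f(2)]
      integral_const_prob_algebra[OF assms(1), of c] integral_const_prob_algebra[OF assms(1), of "- c"]
    by linarith
qed

lemma integral_cong_prob_algebra:
  assumes "\<mu> \<in> space (prob_algebra M)" "\<And>x. x \<in> space M \<Longrightarrow> f x = (g x :: real)"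
  shows "(\<integral>x. f x \<partial>\<mu>) = (\<integral>x. g x \<partial>\<mu>)"
  using assms by (intro Bochner_Integration.integral_cong) (auto simp: space_of_prob_algebra[OF assms(1)])

lemma integral_bind_prob:
  assumes \<mu>: "\<mu> \<in> space (prob_algebra L)" and N: "N \<in> L \<rightarrow>\<^sub>M prob_algebra K"
    and h: "h \<in> bounded_measurable K"
  shows "(\<integral>y. h y \<partial>(\<mu> \<bind> N)) = (\<integral>x. \<integral>y. h y \<partial>N x \<partial>\<mu>)"
proof -
  interpret prob_space \<mu> using \<mu> by (simp add: space_prob_algebra)
  obtain c where c: "\<forall>x\<in>space K. \<bar>h x\<bar> \<le> c" using bounded_measurable_bound[OF h] by blast
  show ?thesis
  proof (rule integral_bind[where B = c and B' = 1 and K = K])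
    show "N \<in> \<mu> \<rightarrow>\<^sub>M subprob_algebra K"
      by (rule measurable_of_prob_algebra[OF \<mu> measurable_prob_algebraD[OF N]])
    show "AE x in \<mu>. emeasure (N x) (space (N x)) \<le> ennreal 1"
    proof (rule AE_I2)
      fix x assume "x \<in> space \<mu>"
      then have "N x \<in> space (prob_algebra K)"
        using measurable_space[OF N] by (simp add: space_of_prob_algebra[OF \<mu>])
      then show "emeasure (N x) (space (N x)) \<le> ennreal 1"
        by (simp add: space_prob_algebra prob_space.emeasure_space_1)
    qed
  qed (use h c finite_measure_axioms in \<open>auto simp: bounded_measurable_measurable\<close>)
qed

section \<open>Markov kernels\<close>

locale markov_chain =
  fixes M :: "'a measure" and P :: "'a \<Rightarrow> 'a measure"
  assumes kernel: "P \<in> M \<rightarrow>\<^sub>M prob_algebra M"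
begin

abbreviation T :: "('a \<Rightarrow> real) \<Rightarrow> 'a \<Rightarrow> real" where
  "T \<equiv> kernel_op P"

lemma kernel_subprob: "P \<in> M \<rightarrow>\<^sub>M subprob_algebra M"
  by (rule measurable_prob_algebraD[OF kernel])

lemma kernel_prob [simp]: "x \<in> space M \<Longrightarrow> P x \<in> space (prob_algebra M)"
  by (rule measurable_space[OF kernel])

lemma kernel_power_prob [simp]:
  "x \<in> space M \<Longrightarrow> kernel_power M P n x \<in> space (prob_algebra M)"
proof (induction n)
  case 0
  then show ?case by (simp add: space_prob_algebra prob_space_return)
next
  case (Suc n)
  then have k: "kernel_power M P n x \<in> space (prob_algebra M)" by simp
  then have "P \<in> kernel_power M P n x \<rightarrow>\<^sub>M prob_algebra M"
    by (rule measurable_of_prob_algebra[OF _ kernel])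
  with k show ?case
    using prob_space_bind'[of "kernel_power M P n x" M P M] sets_bind'[of "kernel_power M P n x" M P M]
      kernel by (simp add: space_prob_algebra)
qed

lemma T_bounded_measurable [simp]:
  assumes "f \<in> bounded_measurable M"
  shows "T f \<in> bounded_measurable M"
proof -
  obtain c where "\<forall>x\<in>space M. \<bar>f x\<bar> \<le> c"
    using bounded_measurable_bound[OF assms] by blast
  then have "\<bar>T f x\<bar> \<le> c" if "x \<in> space M" for x
    using that assms unfolding kernel_op_def by (intro abs_integral_le_bounded_measurable) auto
  moreover have "T f \<in> borel_measurable M"
    unfolding kernel_op_def
    using measurable_compose[OF kernel_subprob integral_measurable_subprob_algebra, of f] assms
    by (simp add: bounded_measurable_measurable)
  ultimately show ?thesis by (rule bounded_measurableI[rotated])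
qed

lemma T_power_bounded_measurable [simp]:
  "f \<in> bounded_measurable M \<Longrightarrow> (T ^^ n) f \<in> bounded_measurable M"
  by (induction n) auto

lemma integral_kernel_power:
  assumes "x \<in> space M" "f \<in> bounded_measurable M"
  shows "(\<integral>y. f y \<partial>kernel_power M P n x) = (T ^^ n) f x"
  using assms(2)
proof (induction n arbitrary: f)
  case 0
  then show ?case using assms(1) by (simp add: integral_return)
next
  case (Suc n)
  have "(\<integral>y. f y \<partial>kernel_power M P (Suc n) x) =
      (\<integral>z. \<integral>y. f y \<partial>P z \<partial>kernel_power M P n x)"
    using integral_bind_prob[OF kernel_power_prob[OF assms(1)] kernel Suc.prems] by simp
  also have "\<dots> = (T ^^ n) (T f) x"
    using Suc.IH[OF T_bounded_measurable[OF Suc.prems]] unfolding kernel_op_def[of P f] .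
  finally show ?case by (simp add: funpow_swap1)
qed

end

section \<open>Regeneration in a small set\<close>

locale minorized_chain = markov_chain +
  fixes C :: "'a set" and m :: nat and \<epsilon> :: real and \<nu> :: "'a measure"
  assumes small: "small_set M P C m \<epsilon> \<nu>"
begin

lemma C_sets [simp]: "C \<in> sets M" and m_pos: "1 \<le> m" and \<epsilon>_pos: "0 < \<epsilon>"
  and \<nu>_prob [simp]: "\<nu> \<in> space (prob_algebra M)"
  and minorization: "x \<in> C \<Longrightarrow> S \<in> sets M \<Longrightarrow>
    \<epsilon> * measure \<nu> S \<le> measure (kernel_power M P m x) S"
  using small by (auto simp: small_set_def)

lemma C_space [simp]: "x \<in> C \<Longrightarrow> x \<in> space M"
  using sets.sets_into_space[OF C_sets] by blast

lemma \<epsilon>_le_1_at: "x \<in> C \<Longrightarrow> \<epsilon> \<le> 1"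
proof -
  assume x: "x \<in> C"
  have "measure \<nu> (space M) = 1" "measure (kernel_power M P m x) (space M) = 1"
    using \<nu>_prob kernel_power_prob[OF C_space[OF x], of m] space_of_prob_algebra
    by (metis (no_types, lifting) mem_Collect_eq prob_space.prob_space space_prob_algebra)+
  then show "\<epsilon> \<le> 1" using minorization[OF x sets.top] by simp
qed

lemma \<nu>_le_kernel_power: "x \<in> C \<Longrightarrow> scale_measure (ennreal \<epsilon>) \<nu> \<le> kernel_power M P m x"
proof -
  assume x: "x \<in> C"
  note k = kernel_power_prob[OF C_space[OF x], of m]
  interpret k: prob_space "kernel_power M P m x" using k by (simp add: space_prob_algebra)
  interpret n: prob_space \<nu> using \<nu>_prob by (simp add: space_prob_algebra)
  have "ennreal \<epsilon> * emeasure \<nu> S \<le> emeasure (kernel_power M P m x) S" if "S \<in> sets M" for S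
    using minorization[OF x that] \<epsilon>_pos
    by (simp add: k.emeasure_eq_measure n.emeasure_eq_measure flip: ennreal_mult)
  then show ?thesis
    by (subst le_measure) (simp_all add: sets_of_prob_algebra[OF k] sets_of_prob_algebra[OF \<nu>_prob])
qed

lemma nn_integral_minorization:
  assumes "x \<in> C" "f \<in> borel_measurable M"
  shows "ennreal \<epsilon> * (\<integral>\<^sup>+y. f y \<partial>\<nu>) \<le> (\<integral>\<^sup>+y. f y \<partial>kernel_power M P m x)"
proof -
  have "ennreal \<epsilon> * (\<integral>\<^sup>+y. f y \<partial>\<nu>) = (\<integral>\<^sup>+y. f y \<partial>scale_measure (ennreal \<epsilon>) \<nu>)"
    using assms(2) by (simp add: nn_integral_scale_measure measurable_of_prob_algebra[OF \<nu>_prob])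
  also have "\<dots> \<le> (\<integral>\<^sup>+y. f y \<partial>kernel_power M P m x)"
    using \<nu>_le_kernel_power[OF assms(1)] sets_of_prob_algebra[OF \<nu>_prob]
      sets_of_prob_algebra[OF kernel_power_prob[OF C_space[OF assms(1)]], of m]
    by (intro nn_integral_mono_measure) simp_all
  finally show ?thesis .
qed

text \<open>For \<open>x \<in> C\<close> this is integration against the positive measure \<open>P\<^sup>m(x,\<cdot>) - \<epsilon>\<nu>\<close>, the law of the
  state at the end of a block of \<open>m\<close> steps from \<open>x\<close> on the event that the block does not regenerate.\<close>
definition residual :: "'a \<Rightarrow> ('a \<Rightarrow> real) \<Rightarrow> real" where
  "residual x f = (\<integral>y. f y \<partial>kernel_power M P m x) - \<epsilon> * (\<integral>y. f y \<partial>\<nu>)"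

lemma residual_nonneg:
  assumes x: "x \<in> C" and f: "f \<in> borel_measurable M" "\<And>y. y \<in> space M \<Longrightarrow> 0 \<le> f y"
    and int: "integrable (kernel_power M P m x) f" "integrable \<nu> f"
  shows "0 \<le> residual x f"
proof -
  note k = kernel_power_prob[OF C_space[OF x], of m]
  have "AE y in \<nu>. 0 \<le> f y" "AE y in kernel_power M P m x. 0 \<le> f y"
    using f(2) by (auto simp: space_of_prob_algebra[OF \<nu>_prob] space_of_prob_algebra[OF k] intro!: AE_I2)
  then have "ennreal (\<epsilon> * (\<integral>y. f y \<partial>\<nu>)) \<le> ennreal (\<integral>y. f y \<partial>kernel_power M P m x)"
    using nn_integral_minorization[OF x, of f] f(1) int \<epsilon>_pos
    by (simp add: nn_integral_eq_integral integral_nonneg_AE ennreal_mult)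
  then show ?thesis
    using \<open>AE y in kernel_power M P m x. 0 \<le> f y\<close>
    by (simp add: residual_def integral_nonneg_AE)
qed

lemma residual_diff:
  assumes "integrable (kernel_power M P m x) f" "integrable \<nu> f"
    "integrable (kernel_power M P m x) g" "integrable \<nu> g"
  shows "residual x (\<lambda>y. f y - g y) = residual x f - residual x g"
  using assms by (simp add: residual_def algebra_simps)

lemma residual_add:
  assumes "integrable (kernel_power M P m x) f" "integrable \<nu> f"
    "integrable (kernel_power M P m x) g" "integrable \<nu> g"
  shows "residual x (\<lambda>y. f y + g y) = residual x f + residual x g"
  using assms by (simp add: residual_def algebra_simps)

lemma residual_mult_right: "residual x (\<lambda>y. f y * c) = residual x f * c"
  by (simp add: residual_def algebra_simps)

lemma residual_mult_left: "residual x (\<lambda>y. c * f y) = c * residual x f"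
  by (simp add: residual_def algebra_simps)

lemma residual_const: "x \<in> C \<Longrightarrow> residual x (\<lambda>y. c) = (1 - \<epsilon>) * c"
  by (simp add: residual_def algebra_simps measure_space_prob_algebra[OF \<nu>_prob]
      measure_space_prob_algebra[OF kernel_power_prob])

lemma residual_mono:
  assumes x: "x \<in> C" and "f \<in> borel_measurable M" "g \<in> borel_measurable M"
    "\<And>y. y \<in> space M \<Longrightarrow> f y \<le> g y"
    "integrable (kernel_power M P m x) f" "integrable \<nu> f"
    "integrable (kernel_power M P m x) g" "integrable \<nu> g"
  shows "residual x f \<le> residual x g"
proof -
  have "0 \<le> residual x (\<lambda>y. g y - f y)"
    using assms by (intro residual_nonneg) auto
  then show ?thesis using assms by (simp add: residual_diff)
qed

lemma residual_bounded_measurable: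
  assumes "f \<in> bounded_measurable M"
  shows "\<exists>g\<in>bounded_measurable M. \<forall>x\<in>space M. residual x f = g x"
  using assms
  by (intro bexI[of _ "\<lambda>x. (T ^^ m) f x - \<epsilon> * (\<integral>y. f y \<partial>\<nu>)"])
    (auto simp: residual_def integral_kernel_power)

text \<open>Let \<open>\<tau>\<close> be the regeneration time: outside \<open>C\<close> the chain makes a single step; from a point of \<open>C\<close>
  it makes a block of \<open>m\<close> steps, at the end of which it regenerates with probability \<open>\<epsilon>\<close>, and if it
  does not, the state follows the residual law. Then \<open>surv n f x\<close> is \<open>E\<^sub>x[f(X\<^sub>n); \<tau> > n]\<close> and
  \<open>regen n x\<close> is \<open>Pr\<^sub>x(\<tau> = n)\<close>, both written as recursions over the first step or block. At times
  before the end of a first block no regeneration has happened and \<open>X\<^sub>n\<close> has its unconditional law,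
  whence the power of the transition operator. The disjunct \<open>m = 0\<close> ensures termination for every
  value of the parameter \<open>m\<close>.\<close>
fun surv :: "nat \<Rightarrow> ('a \<Rightarrow> real) \<Rightarrow> 'a \<Rightarrow> real" where
  "surv n f = (\<lambda>x.
     if n = 0 then f x
     else if x \<notin> C then T (surv (n - 1) f) x
     else if n < m \<or> m = 0 then (T ^^ n) f x
     else residual x (surv (n - m) f))"

fun regen :: "nat \<Rightarrow> 'a \<Rightarrow> real" where
  "regen n = (\<lambda>x.
     if n = 0 then 0
     else if x \<notin> C then T (regen (n - 1)) x
     else if n < m \<or> m = 0 then 0
     else residual x (regen (n - m)) + (if n = m then \<epsilon> else 0))"

declare surv.simps [simp del] regen.simps [simp del]

lemma surv_0 [simp]: "surv 0 f = f"
  by (subst surv.simps) simp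

lemma surv_outside: "x \<notin> C \<Longrightarrow> 0 < n \<Longrightarrow> surv n f x = T (surv (n - 1) f) x"
  by (subst surv.simps) simp

lemma surv_early: "x \<in> C \<Longrightarrow> n < m \<Longrightarrow> surv n f x = (T ^^ n) f x"
  by (subst surv.simps) simp

lemma surv_late: "x \<in> C \<Longrightarrow> m \<le> n \<Longrightarrow> surv n f x = residual x (surv (n - m) f)"
  using m_pos by (subst surv.simps) simp

lemma regen_0 [simp]: "regen 0 = (\<lambda>x. 0)"
  by (subst regen.simps) simp

lemma regen_outside: "x \<notin> C \<Longrightarrow> 0 < n \<Longrightarrow> regen n x = T (regen (n - 1)) x"
  by (subst regen.simps) simp

lemma regen_early: "x \<in> C \<Longrightarrow> n < m \<Longrightarrow> regen n x = 0"
  by (subst regen.simps) simp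

lemma regen_late: "x \<in> C \<Longrightarrow> m \<le> n \<Longrightarrow>
    regen n x = residual x (regen (n - m)) + (if n = m then \<epsilon> else 0)"
  using m_pos by (subst regen.simps) simp

text \<open>The recursion scheme of \<open>surv\<close> and \<open>regen\<close> as an induction rule on the points of the state space.\<close>
lemma first_step_induct [consumes 1, case_names zero outside early late]:
  fixes Q :: "nat \<Rightarrow> 'a \<Rightarrow> bool"
  assumes "x \<in> space M"
    and zero: "\<And>x. x \<in> space M \<Longrightarrow> Q 0 x"
    and outside: "\<And>n x. 0 < n \<Longrightarrow> x \<in> space M \<Longrightarrow> x \<notin> C \<Longrightarrow>
      (\<And>y. y \<in> space M \<Longrightarrow> Q (n - 1) y) \<Longrightarrow> Q n x"
    and early: "\<And>n x. x \<in> C \<Longrightarrow> x \<in> space M \<Longrightarrow> 0 < n \<Longrightarrow> n < m \<Longrightarrow> Q n x"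
    and late: "\<And>n x. x \<in> C \<Longrightarrow> x \<in> space M \<Longrightarrow> m \<le> n \<Longrightarrow>
      (\<And>y. y \<in> space M \<Longrightarrow> Q (n - m) y) \<Longrightarrow> Q n x"
  shows "Q n x"
  using assms(1)
proof (induction n arbitrary: x rule: less_induct)
  case (less n)
  consider "n = 0" | "0 < n" "x \<notin> C" | "x \<in> C" "0 < n" "n < m" | "x \<in> C" "m \<le> n"
    by linarith
  then show ?case
  proof cases
    case 1 then show ?thesis using zero less.prems by simp
  next
    case 2 then show ?thesis using outside[of n x] less by simp
  next
    case 3 then show ?thesis using early less.prems by simp
  next
    case 4 then show ?thesis using late[of x n] less m_pos by simp
  qed
qed

lemma bounded_measurable_case_C:
  assumes "f \<in> bounded_measurable M" "g \<in> bounded_measurable M"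
    "\<And>x. x \<in> space M \<Longrightarrow> x \<notin> C \<Longrightarrow> h x = f x" "\<And>x. x \<in> C \<Longrightarrow> h x = g x"
  shows "h \<in> bounded_measurable M"
proof -
  have "(\<lambda>x. indicator C x * g x + (1 - indicator C x) * f x) \<in> bounded_measurable M"
    using assms(1,2) by (intro bounded_measurable_add bounded_measurable_mult bounded_measurable_diff) auto
  then show ?thesis
    by (rule bounded_measurable_cong[THEN iffD1, rotated])
      (use assms(3,4) in \<open>auto simp: indicator_def\<close>)
qed

lemma surv_bounded_measurable [simp]:
  assumes f: "f \<in> bounded_measurable M"
  shows "surv n f \<in> bounded_measurable M"
proof (induction n rule: less_induct)
  case (less n)
  consider "n = 0" | "0 < n" "n < m" | "m \<le> n"
    by linarith
  then show ?case
  proof cases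
    case 1 then show ?thesis using f by simp
  next
    case 2
    show ?thesis
      by (rule bounded_measurable_case_C[of "T (surv (n - 1) f)" "(T ^^ n) f"])
        (use 2 less f in \<open>auto simp: surv_outside surv_early\<close>)
  next
    case 3
    have "n - m < n" using 3 m_pos by simp
    obtain g where g: "g \<in> bounded_measurable M" "\<forall>x\<in>space M. residual x (surv (n - m) f) = g x"
      using residual_bounded_measurable[OF less[OF \<open>n - m < n\<close>]] by (elim bexE)
    show ?thesis
      by (rule bounded_measurable_case_C[of "T (surv (n - 1) f)" g])
        (use g 3 less f m_pos in \<open>auto simp: surv_outside surv_late\<close>)
  qed
qed

lemma regen_bounded_measurable [simp]: "regen n \<in> bounded_measurable M"
proof (induction n rule: less_induct)
  case (less n)
  consider "n = 0" | "0 < n" "n < m" | "m \<le> n"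
    by linarith
  then show ?case
  proof cases
    case 1 then show ?thesis by simp
  next
    case 2
    show ?thesis
      by (rule bounded_measurable_case_C[of "T (regen (n - 1))" "\<lambda>x. 0"])
        (use 2 less in \<open>auto simp: regen_outside regen_early\<close>)
  next
    case 3
    have "n - m < n" using 3 m_pos by simp
    obtain g where g: "g \<in> bounded_measurable M" "\<forall>x\<in>space M. residual x (regen (n - m)) = g x"
      using residual_bounded_measurable[OF less[OF \<open>n - m < n\<close>]] by (elim bexE)
    show ?thesis
      by (rule bounded_measurable_case_C[of "T (regen (n - 1))" "\<lambda>x. g x + (if n = m then \<epsilon> else 0)"])
        (use g 3 less m_pos in \<open>auto simp: regen_outside regen_late\<close>)
  qed
qed

lemma integrable_at_C:
  assumes "x \<in> C" "f \<in> bounded_measurable M"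
  shows "integrable (kernel_power M P m x) f" "integrable \<nu> f"
  using integrable_bounded_measurable[OF kernel_power_prob[OF C_space[OF assms(1)]] assms(2)]
    integrable_bounded_measurable[OF \<nu>_prob assms(2)] by simp_all

lemma regen_nonneg: "x \<in> space M \<Longrightarrow> 0 \<le> regen n x"
proof (induction n x rule: first_step_induct)
  case (outside n x)
  then show ?case
    unfolding regen_outside[OF outside(3,1)] kernel_op_def
    by (intro integral_bounded_measurable_nonneg[OF kernel_prob]) auto
next
  case (late n x)
  then have "0 \<le> residual x (regen (n - m))"
    using residual_nonneg[OF late(1), of "regen (n - m)"] integrable_at_C[OF late(1)]
    by (simp add: bounded_measurable_measurable)
  then show ?case using \<epsilon>_pos late by (simp add: regen_late)
qed (auto simp: regen_early)

lemma surv_mono: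
  assumes "f \<in> bounded_measurable M" "g \<in> bounded_measurable M"
    and le: "\<And>y. y \<in> space M \<Longrightarrow> f y \<le> g y"
  shows "x \<in> space M \<Longrightarrow> surv n f x \<le> surv n g x"
proof (induction n x rule: first_step_induct)
  case (outside n x)
  then show ?case
    unfolding surv_outside[OF outside(3,1)] kernel_op_def using assms
    by (intro integral_mono_bounded_measurable[OF kernel_prob]) auto
next
  case (early n x)
  then show ?case
    using assms integral_mono_bounded_measurable[OF kernel_power_prob, of x f g n]
    by (simp add: surv_early integral_kernel_power)
next
  case (late n x)
  then show ?case
    using residual_mono[OF late(1), of "surv (n - m) f" "surv (n - m) g"] assms
      integrable_at_C[OF late(1)]
    by (simp add: surv_late bounded_measurable_measurable)
qed (use le in auto)

lemma T_power_cmult: "(T ^^ n) (\<lambda>y. c * f y) = (\<lambda>x. c * (T ^^ n) f x)"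
  by (induction n) (simp_all add: kernel_op_def)

lemma T_cong: "x \<in> space M \<Longrightarrow> (\<And>y. y \<in> space M \<Longrightarrow> f y = g y) \<Longrightarrow> T f x = T g x"
  unfolding kernel_op_def by (rule integral_cong_prob_algebra[OF kernel_prob])

lemma residual_cong:
  "x \<in> C \<Longrightarrow> (\<And>y. y \<in> space M \<Longrightarrow> f y = g y) \<Longrightarrow> residual x f = residual x g"
  unfolding residual_def
  using integral_cong_prob_algebra[OF kernel_power_prob[OF C_space], of x f g m]
    integral_cong_prob_algebra[OF \<nu>_prob, of f g] by simp

lemma surv_cmult:
  "x \<in> space M \<Longrightarrow> surv n (\<lambda>y. c * f y) x = c * surv n f x"
proof (induction n x rule: first_step_induct)
  case (outside n x)
  then show ?case
    using T_cong[of x "surv (n - 1) (\<lambda>y. c * f y)" "\<lambda>y. c * surv (n - 1) f y"]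
    by (simp add: surv_outside) (simp add: kernel_op_def)
next
  case (late n x)
  then show ?case
    using residual_cong[of x "surv (n - m) (\<lambda>y. c * f y)" "\<lambda>y. c * surv (n - m) f y"]
    by (simp add: surv_late residual_mult_left)
qed (auto simp: surv_early T_power_cmult)

lemma surv_nonneg:
  assumes "f \<in> bounded_measurable M" "\<And>y. y \<in> space M \<Longrightarrow> 0 \<le> f y" "x \<in> space M"
  shows "0 \<le> surv n f x"
  using surv_mono[of "\<lambda>y. 0" f x n] surv_cmult[of x n 0 f] assms by simp

lemma abs_surv_le:
  assumes "f \<in> bounded_measurable M" "\<And>y. y \<in> space M \<Longrightarrow> \<bar>f y\<bar> \<le> c" "x \<in> space M"
  shows "\<bar>surv n f x\<bar> \<le> c * surv n (\<lambda>y. 1) x"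
proof -
  have f: "f y \<le> c" "- c \<le> f y" if "y \<in> space M" for y
    using assms(2)[OF that] by auto
  show ?thesis
    using surv_mono[of f "\<lambda>y. c" x n] surv_mono[of "\<lambda>y. - c" f x n] f assms(1,3)
      surv_cmult[of x n c "\<lambda>y. 1"] surv_cmult[of x n "- c" "\<lambda>y. 1"] by simp
qed

lemma T_power_const: "x \<in> space M \<Longrightarrow> (T ^^ n) (\<lambda>y. c) x = c"
  using integral_kernel_power[of x "\<lambda>y. c" n] integral_const_prob_algebra[OF kernel_power_prob, of x n c]
  by (simp del: lebesgue_integral_const)

lemma integral_lin_comb:
  assumes "\<mu> \<in> space (prob_algebra M)"
    "\<And>k. k \<le> n \<Longrightarrow> g k \<in> bounded_measurable M" "h \<in> bounded_measurable M"
  shows "(\<integral>y. ((\<Sum>k\<le>n. g k y * w k) + h y) \<partial>\<mu>) = (\<Sum>k\<le>n. (\<integral>y. g k y \<partial>\<mu>) * w k) + (\<integral>y. h y \<partial>\<mu>)"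
proof -
  have "integrable \<mu> (\<lambda>y. g k y * w k)" if "k \<le> n" for k
    using assms that integrable_bounded_measurable[OF assms(1), of "\<lambda>y. g k y * w k"] by simp
  then show ?thesis
    using integrable_bounded_measurable[OF assms(1,3)]
    by (subst Bochner_Integration.integral_add) (auto intro!: Bochner_Integration.integrable_sum)
qed

text \<open>Split at the regeneration time: given \<open>\<tau> = k\<close>, the chain after time \<open>k\<close> is a fresh chain started
  from \<open>\<nu>\<close>. In the proof both sides obey the recursion over the first step; for a block one uses that
  \<open>P\<^sup>m\<close> is the residual law plus \<open>\<epsilon>\<nu>\<close>.\<close>
theorem renewal_decomposition:
  assumes f: "f \<in> bounded_measurable M"
  shows "x \<in> space M \<Longrightarrow>
    (T ^^ n) f x = (\<Sum>k\<le>n. regen k x * (\<integral>y. (T ^^ (n - k)) f y \<partial>\<nu>)) + surv n f x"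
proof (induction n x rule: first_step_induct)
  case (outside n x)
  define w where "w j = (\<integral>y. (T ^^ j) f y \<partial>\<nu>)" for j
  obtain n' where n: "n = Suc n'" using outside(1) by (cases n) auto
  have "(T ^^ n) f x = T ((T ^^ n') f) x" by (simp add: n)
  also have "\<dots> = T (\<lambda>y. (\<Sum>k\<le>n'. regen k y * w (n' - k)) + surv n' f y) x"
    using outside by (intro T_cong) (auto simp: n w_def)
  also have "\<dots> = (\<Sum>k\<le>n'. T (regen k) x * w (n' - k)) + T (surv n' f) x"
    unfolding kernel_op_def using outside f by (intro integral_lin_comb) auto
  also have "\<dots> = (\<Sum>k\<le>n'. regen (Suc k) x * w (n - Suc k)) + surv n f x"
    using outside by (simp add: n regen_outside surv_outside)
  also have "\<dots> = (\<Sum>k\<le>n. regen k x * w (n - k)) + surv n f x"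
    unfolding n sum.atMost_Suc_shift by simp
  finally show ?case by (simp add: w_def)
next
  case (early n x)
  then show ?case by (auto simp: surv_early regen_early intro!: sum.neutral)
next
  case (late n x)
  define w where "w j = (\<integral>y. (T ^^ j) f y \<partial>\<nu>)" for j
  define n' where "n' = n - m"
  have n: "n = n' + m" using late by (simp add: n'_def)
  note k = kernel_power_prob[OF late(2), of m]
  have "(T ^^ n) f x = (T ^^ m) ((T ^^ n') f) x" by (simp add: n funpow_add add.commute[of n'])
  also have "\<dots> = residual x ((T ^^ n') f) + \<epsilon> * w n'"
    using late f by (simp add: residual_def integral_kernel_power w_def)
  also have "residual x ((T ^^ n') f) =
      residual x (\<lambda>y. (\<Sum>k\<le>n'. regen k y * w (n' - k)) + surv n' f y)"
    using late by (intro residual_cong) (auto simp: n'_def w_def)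
  also have "\<dots> = (\<Sum>k\<le>n'. residual x (regen k) * w (n' - k)) + residual x (surv n' f)"
  proof -
    have "(\<integral>y. ((\<Sum>k\<le>n'. regen k y * w (n' - k)) + surv n' f y) \<partial>\<mu>) =
        (\<Sum>k\<le>n'. (\<integral>y. regen k y \<partial>\<mu>) * w (n' - k)) + (\<integral>y. surv n' f y \<partial>\<mu>)"
      if "\<mu> \<in> space (prob_algebra M)" for \<mu>
      using f that by (intro integral_lin_comb) auto
    from this[OF k] this[OF \<nu>_prob] show ?thesis
      by (simp add: residual_def sum_distrib_left sum_subtractf algebra_simps)
  qed
  \<comment> \<open>The mass \<open>\<epsilon>\<close> regenerating at the end of the first block is booked at \<open>k = 0\<close>, which becomes
    the time \<open>m\<close> after the shift by \<open>m\<close>.\<close>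
  also have "(\<Sum>k\<le>n'. residual x (regen k) * w (n' - k)) + residual x (surv n' f) + \<epsilon> * w n' =
      (\<Sum>k\<le>n'. (residual x (regen k) + (if k = 0 then \<epsilon> else 0)) * w (n' - k)) + surv n f x"
    using late by (simp add: n'_def surv_late distrib_right sum.distrib if_distrib[of "\<lambda>z. z * _"] cong: if_cong)
  also have "\<dots> = (\<Sum>k\<le>n'. regen (k + m) x * w (n - (k + m))) + surv n f x"
    using late by (simp add: n regen_late)
  also have "(\<Sum>k\<le>n'. regen (k + m) x * w (n - (k + m))) = (\<Sum>k=m..n. regen k x * w (n - k))"
    by (rule sum.reindex_bij_witness[of _ "\<lambda>k. k - m" "\<lambda>k. k + m"]) (auto simp: n)
  also have "\<dots> = (\<Sum>k\<le>n. regen k x * w (n - k))"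
    using late by (intro sum.mono_neutral_left) (auto simp: regen_early not_le)
  finally show ?case by (simp add: w_def)
qed simp

lemma sum_regen: "x \<in> space M \<Longrightarrow> (\<Sum>k\<le>n. regen k x) = 1 - surv n (\<lambda>y. 1) x"
proof -
  assume x: "x \<in> space M"
  have "(\<integral>y. (T ^^ j) (\<lambda>y. 1) y \<partial>\<nu>) = 1" for j
    using integral_cong_prob_algebra[OF \<nu>_prob, of "(T ^^ j) (\<lambda>y. 1)" "\<lambda>y. 1"] T_power_const[of _ j 1]
      measure_space_prob_algebra[OF \<nu>_prob] by simp
  then show ?thesis
    using renewal_decomposition[of "\<lambda>y. 1" x n] x by (simp add: T_power_const)
qed

lemma surv_one_le_1: "x \<in> space M \<Longrightarrow> surv n (\<lambda>y. 1) x \<le> 1"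
  using sum_regen[of x n] sum_nonneg[of "{..n}" "\<lambda>k. regen k x"] regen_nonneg by simp

end

section \<open>The tail of the regeneration time under a drift condition\<close>

text \<open>A concave function lies below its tangent at \<open>c\<close>. Applying a positive linear functional to both
  sides yields Jensen's inequality, also for functionals of total mass different from \<open>1\<close> such as the
  residual law.\<close>
lemma powr_le_tangent:
  fixes v c r :: real
  assumes "0 \<le> r" "r \<le> 1" "0 < v" "0 < c"
  shows "v powr r \<le> c powr r + r * c powr (r - 1) * (v - c)"
proof -
  have "v powr r * c powr (1 - r) \<le> r * v + (1 - r) * c"
    using assms by (intro Youngs_inequality_0) auto
  then have "(v powr r * c powr (1 - r)) * c powr (r - 1) \<le> (r * v + (1 - r) * c) * c powr (r - 1)"
    by (rule mult_right_mono) simp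
  moreover have "c powr (1 - r) * c powr (r - 1) = 1" "c powr r = c * c powr (r - 1)"
    using assms(4) by (simp_all add: powr_diff field_simps powr_add[symmetric])
  ultimately show ?thesis by (simp add: algebra_simps)
qed

lemma powr_le_self:
  fixes v r :: real
  assumes "r \<le> 1" "1 \<le> v"
  shows "v powr r \<le> v"
  using powr_mono[of r 1 v] assms by simp

lemma integrable_powr:
  assumes "integrable \<mu> V" "AE x in \<mu>. 1 \<le> V x" "0 \<le> r" "r \<le> 1"
  shows "integrable \<mu> (\<lambda>x. V x powr r :: real)"
  using assms(2) by (intro Bochner_Integration.integrable_bound[OF assms(1)])
    (use assms in \<open>auto elim!: eventually_mono simp: powr_le_self\<close>)

lemma integral_powr_le:
  assumes \<mu>: "\<mu> \<in> space (prob_algebra M)" and int: "integrable \<mu> V"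
    and V: "\<And>x. x \<in> space M \<Longrightarrow> 1 \<le> V x" and r: "0 \<le> r" "r \<le> 1"
    and c: "0 < c" "(\<integral>x. V x \<partial>\<mu>) \<le> c"
  shows "(\<integral>x. V x powr r \<partial>\<mu>) \<le> (c::real) powr r"
proof -
  interpret prob_space \<mu> using \<mu> by (simp add: space_prob_algebra)
  have V': "1 \<le> V x" if "x \<in> space \<mu>" for x using V that space_of_prob_algebra[OF \<mu>] by simp
  then have "(\<integral>x. V x powr r \<partial>\<mu>) \<le> (\<integral>x. c powr r + r * c powr (r - 1) * (V x - c) \<partial>\<mu>)"
    using int r c by (intro integral_mono integrable_powr powr_le_tangent) (auto intro: less_le_trans[OF zero_less_one])
  also have "\<dots> = c powr r + r * c powr (r - 1) * ((\<integral>x. V x \<partial>\<mu>) - c)"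
    using int by (simp add: prob_space)
  also have "\<dots> \<le> c powr r"
    using c r by (simp add: mult_nonneg_nonpos)
  finally show ?thesis .
qed

context minorized_chain begin

text \<open>If \<open>\<epsilon> = 1\<close>, the minorization holds for a set and for its complement with total masses \<open>1\<close> on both
  sides, so \<open>P\<^sup>m(x,\<cdot>)\<close> equals \<open>\<nu>\<close> and a block always regenerates.\<close>
lemma residual_eq_0:
  assumes "\<epsilon> = 1" and x: "x \<in> C"
  shows "residual x f = 0"
proof -
  note k = kernel_power_prob[OF C_space[OF x], of m]
  interpret k: prob_space "kernel_power M P m x" using k by (simp add: space_prob_algebra)
  interpret n: prob_space \<nu> using \<nu>_prob by (simp add: space_prob_algebra)
  note sets = sets_of_prob_algebra[OF k] sets_of_prob_algebra[OF \<nu>_prob]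
  note space = space_of_prob_algebra[OF k] space_of_prob_algebra[OF \<nu>_prob]
  have "kernel_power M P m x = \<nu>"
  proof (rule measure_eqI)
    fix S assume S: "S \<in> sets (kernel_power M P m x)"
    then have S': "S \<in> sets M" "space M - S \<in> sets M" using sets by auto
    have "measure \<nu> S \<le> measure (kernel_power M P m x) S"
      "measure \<nu> (space M - S) \<le> measure (kernel_power M P m x) (space M - S)"
      using minorization[OF x] S' \<open>\<epsilon> = 1\<close> by fastforce+
    moreover have "measure \<nu> (space M - S) = 1 - measure \<nu> S"
      "measure (kernel_power M P m x) (space M - S) = 1 - measure (kernel_power M P m x) S"
      using n.prob_compl[of S] k.prob_compl[of S] S' sets space by simp_all
    ultimately show "emeasure (kernel_power M P m x) S = emeasure \<nu> S"
      by (simp add: k.emeasure_eq_measure n.emeasure_eq_measure)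
  qed (simp add: sets)
  then show ?thesis unfolding residual_def using \<open>\<epsilon> = 1\<close> by simp
qed

lemma residual_powr_le:
  assumes x: "x \<in> C" and meas: "V \<in> borel_measurable M"
    and int: "integrable (kernel_power M P m x) V" "integrable \<nu> V"
    and V: "\<And>y. y \<in> space M \<Longrightarrow> 1 \<le> V y" and r: "0 \<le> r" "r \<le> 1"
    and c: "0 < c" "residual x V \<le> (1 - \<epsilon>) * c"
  shows "residual x (\<lambda>y. V y powr r) \<le> (1 - \<epsilon>) * c powr r"
proof -
  note k = kernel_power_prob[OF C_space[OF x], of m]
  interpret k: prob_space "kernel_power M P m x" using k by (simp add: space_prob_algebra)
  interpret n: prob_space \<nu> using \<nu>_prob by (simp add: space_prob_algebra)
  define b where "b = r * c powr (r - 1)"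
  have AE: "AE y in kernel_power M P m x. 1 \<le> V y" "AE y in \<nu>. 1 \<le> V y"
    using V space_of_prob_algebra[OF k] space_of_prob_algebra[OF \<nu>_prob] by auto
  have "residual x (\<lambda>y. V y powr r) \<le> residual x (\<lambda>y. (c powr r - b * c) + b * V y)"
  proof (rule residual_mono[OF x])
    show "V y powr r \<le> (c powr r - b * c) + b * V y" if "y \<in> space M" for y
      using powr_le_tangent[of r "V y" c] V[OF that] r c by (simp add: b_def algebra_simps)
  qed (use meas int AE r in \<open>auto intro!: integrable_powr\<close>)
  also have "\<dots> = (1 - \<epsilon>) * (c powr r - b * c) + b * residual x V"
    using int x by (simp add: residual_add residual_const residual_mult_left)
  also have "\<dots> \<le> (1 - \<epsilon>) * (c powr r - b * c) + b * ((1 - \<epsilon>) * c)"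
    using c r by (intro add_left_mono mult_left_mono) (auto simp: b_def)
  finally show ?thesis by (simp add: algebra_simps)
qed

text \<open>As long as there is no regeneration, \<open>U\<close> loses a factor \<open>\<rho>\<close> in a step outside \<open>C\<close> and a factor
  \<open>\<rho>\<^sup>m\<close> over a block, so up to time \<open>n\<close> it loses \<open>\<rho>\<^sup>k\<close> where \<open>k\<close> is the start of the current step or
  block. Since \<open>k\<close> can be as small as \<open>n - m + 1\<close>, the factor \<open>\<rho> powi (1 - int m)\<close> appears.\<close>
lemma surv_one_le_of_contraction:
  assumes U: "U \<in> borel_measurable M" "\<And>y. y \<in> space M \<Longrightarrow> 1 \<le> U y" "0 < \<rho>" "\<rho> \<le> 1"
    and outside: "\<And>y. y \<in> space M \<Longrightarrow> y \<notin> C \<Longrightarrow> integrable (P y) U"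
      "\<And>y. y \<in> space M \<Longrightarrow> y \<notin> C \<Longrightarrow> T U y \<le> \<rho> * U y"
    and inside: "\<And>y. y \<in> C \<Longrightarrow> integrable (kernel_power M P m y) U" "integrable \<nu> U"
      "\<And>y. y \<in> C \<Longrightarrow> residual y U \<le> \<rho> ^ m"
    and x: "x \<in> space M"
  shows "surv n (\<lambda>y. 1) x \<le> U x * \<rho> powi (1 - int m) * \<rho> ^ n"
  using x
proof -
  define c where "c = \<rho> powi (1 - int m)"
  have c1: "c * \<rho> ^ (m - 1) = 1"
    using m_pos \<open>0 < \<rho>\<close>
    by (simp add: c_def power_int_def of_nat_diff nat_diff_distrib' power_inverse Suc_nat_eq_nat_zadd1)
  then have c_pos: "0 < c" using \<open>0 < \<rho>\<close>
    by (simp add: c_def zero_less_power_int)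
  have c_ge: "1 \<le> c"
    using c1 c_pos mult_left_le[of "\<rho> ^ (m - 1)" c] U by (simp add: power_le_one)
  from x show ?thesis unfolding c_def[symmetric]
  proof (induction n x rule: first_step_induct)
    case (zero x)
    then show ?case using U(2)[of x] c_ge mult_mono[of 1 "U x" 1 c] by simp
  next
    case (outside n x)
    have "T (surv (n - 1) (\<lambda>y. 1)) x \<le> (\<integral>y. U y * (c * \<rho> ^ (n - 1)) \<partial>P x)"
      unfolding kernel_op_def
      using outside assms(5) space_of_prob_algebra[OF kernel_prob[OF outside(2)]]
      by (intro integral_mono) (auto simp: mult.assoc intro!: integrable_bounded_measurable[OF kernel_prob])
    also have "\<dots> = T U x * (c * \<rho> ^ (n - 1))" by (simp add: kernel_op_def)
    also have "\<dots> \<le> (\<rho> * U x) * (c * \<rho> ^ (n - 1))"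
      using outside assms(6) U c_pos by (intro mult_right_mono) auto
    also have "\<dots> = U x * c * \<rho> ^ n"
      using \<open>0 < n\<close> by (simp add: power_eq_if)
    finally show ?case using outside by (simp add: surv_outside)
  next
    case (early n x)
    have "1 \<le> c * \<rho> ^ n"
      using c1 c_pos U early power_decreasing[of n "m - 1" \<rho>] mult_left_mono[of "\<rho> ^ (m - 1)" "\<rho> ^ n" c]
      by simp
    then show ?case using U(2)[OF early(2)] mult_mono[of 1 "U x" 1 "c * \<rho> ^ n"] early
      by (simp add: surv_early T_power_const mult.assoc)
  next
    case (late n x)
    have "residual x (surv (n - m) (\<lambda>y. 1)) \<le> residual x (\<lambda>y. U y * (c * \<rho> ^ (n - m)))"
    proof (rule residual_mono[OF late(1)])
      show "(\<lambda>y. U y * (c * \<rho> ^ (n - m))) \<in> borel_measurable M"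
        using U(1) by measurable
      show "surv (n - m) (\<lambda>y. 1) y \<le> U y * (c * \<rho> ^ (n - m))" if "y \<in> space M" for y
        using late(4)[OF that] by (simp add: mult.assoc)
    qed (simp_all add: bounded_measurable_measurable integrable_at_C[OF late(1)] U(1) inside(1)[OF late(1)] inside(2))
  also have "\<dots> \<le> \<rho> ^ m * (c * \<rho> ^ (n - m))"
      unfolding residual_mult_right
      using inside(3)[OF late(1)] c_pos U by (intro mult_right_mono) auto
    also have "\<dots> = 1 * (c * \<rho> ^ n)"
      using late by (simp flip: power_add)
    also have "\<dots> \<le> U x * (c * \<rho> ^ n)"
      using U late c_pos by (intro mult_right_mono) auto
    finally show ?case using late by (simp add: surv_late mult.assoc)
  qed
qed

end

context markov_chain begin

lemma nn_integral_kernel_power_Suc: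
  assumes "f \<in> borel_measurable M" "x \<in> space M"
  shows "(\<integral>\<^sup>+y. f y \<partial>kernel_power M P (Suc n) x) = (\<integral>\<^sup>+z. (\<integral>\<^sup>+y. f y \<partial>P z) \<partial>kernel_power M P n x)"
  using nn_integral_bind[OF assms(1)
      measurable_of_prob_algebra[OF kernel_power_prob[OF assms(2)] kernel_subprob]] by simp

lemma kernel_power_1: "x \<in> space M \<Longrightarrow> kernel_power M P 1 x = P x"
  using bind_return[OF kernel_subprob, of x] by simp

lemma nn_integral_kernel_power_affine:
  assumes V: "V \<in> borel_measurable M" "\<And>y. y \<in> space M \<Longrightarrow> 0 \<le> V y" and ab: "0 \<le> a" "0 \<le> b"
    and step: "\<And>y. y \<in> space M \<Longrightarrow> (\<integral>\<^sup>+z. ennreal (V z) \<partial>P y) \<le> ennreal (a * V y + b)"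
    and x: "x \<in> space M" and u: "(\<integral>\<^sup>+z. ennreal (V z) \<partial>kernel_power M P n x) \<le> ennreal u" "0 \<le> u"
  shows "(\<integral>\<^sup>+z. ennreal (V z) \<partial>kernel_power M P (Suc n) x) \<le> ennreal (a * u + b)"
proof -
  note k = kernel_power_prob[OF x, of n]
  have [measurable]: "V \<in> borel_measurable (kernel_power M P n x)"
    by (rule measurable_of_prob_algebra[OF k V(1)])
  interpret k: prob_space "kernel_power M P n x" using k by (simp add: space_prob_algebra)
  have "(\<integral>\<^sup>+z. ennreal (V z) \<partial>kernel_power M P (Suc n) x)
      \<le> (\<integral>\<^sup>+y. (ennreal a * ennreal (V y) + ennreal b) \<partial>kernel_power M P n x)"
    using step V ab x space_of_prob_algebra[OF k]
    by (subst nn_integral_kernel_power_Suc) (auto intro!: nn_integral_mono simp: ennreal_mult ennreal_plus)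
  also have "\<dots> = ennreal a * (\<integral>\<^sup>+y. ennreal (V y) \<partial>kernel_power M P n x) + ennreal b"
    by (simp add: nn_integral_add nn_integral_cmult k.emeasure_space_1)
  also have "\<dots> \<le> ennreal a * ennreal u + ennreal b"
    using u by (intro add_right_mono mult_left_mono) auto
  also have "\<dots> = ennreal (a * u + b)"
    using ab u by (simp add: ennreal_mult ennreal_plus)
  finally show ?thesis .
qed

end

locale drift_chain = minorized_chain +
  fixes V :: "'a \<Rightarrow> real" and l K :: real
  assumes drift: "drift_function M P C V l K"
    and nonempty: "space M \<noteq> {}"
begin

lemma V_measurable [measurable]: "V \<in> borel_measurable M"
  and V_ge_1: "x \<in> space M \<Longrightarrow> 1 \<le> V x"
  and l_pos: "0 < l" and l_less_1: "l < 1"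
  and drift_outside: "x \<in> space M \<Longrightarrow> x \<notin> C \<Longrightarrow> (\<integral>\<^sup>+y. ennreal (V y) \<partial>P x) \<le> ennreal (l * V x)"
  and drift_inside: "x \<in> C \<Longrightarrow> (\<integral>\<^sup>+y. ennreal (V y) \<partial>P x) \<le> ennreal K"
  using drift by (auto simp: drift_function_def)

lemma V_nonneg: "x \<in> space M \<Longrightarrow> 0 \<le> V x"
  using V_ge_1[of x] by simp

lemma nn_integral_V_ge_1:
  assumes "\<mu> \<in> space (prob_algebra M)"
  shows "1 \<le> (\<integral>\<^sup>+y. ennreal (V y) \<partial>\<mu>)"
proof -
  interpret prob_space \<mu> using assms by (simp add: space_prob_algebra)
  have "(\<integral>\<^sup>+y. 1 \<partial>\<mu>) \<le> (\<integral>\<^sup>+y. ennreal (V y) \<partial>\<mu>)"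
    using V_ge_1 space_of_prob_algebra[OF assms] by (intro nn_integral_mono) auto
  then show ?thesis by (simp add: emeasure_space_1)
qed

text \<open>Otherwise the drift condition would make the expectation of \<open>V(X\<^sub>n)\<close> tend to \<open>0\<close>, although
  \<open>V \<ge> 1\<close>.\<close>
lemma C_nonempty: "C \<noteq> {}"
proof
  assume "C = {}"
  obtain x where x: "x \<in> space M" using nonempty by blast
  have le: "(\<integral>\<^sup>+z. ennreal (V z) \<partial>kernel_power M P n x) \<le> ennreal (l ^ n * V x)" for n
  proof (induction n)
    case 0
    then show ?case using x by (simp add: nn_integral_return)
  next
    case (Suc n)
    show ?case
      using nn_integral_kernel_power_affine[OF V_measurable V_nonneg, of l 0 x n "l ^ n * V x"]
        Suc x l_pos V_nonneg[OF x] drift_outside \<open>C = {}\<close> by (simp add: mult.assoc)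
  qed
  have "(\<lambda>n. l ^ n * V x) \<longlonglongrightarrow> 0 * V x"
    using l_pos l_less_1 by (intro tendsto_mult LIMSEQ_power_zero tendsto_const) simp
  then have "eventually (\<lambda>n. l ^ n * V x < 1) sequentially"
    using order_tendstoD(2)[of "\<lambda>n. l ^ n * V x" 0 sequentially 1] by simp
  then obtain n where "l ^ n * V x < 1" by (rule eventually_happens'[OF sequentially_bot, THEN exE])
  moreover have "1 \<le> ennreal (l ^ n * V x)"
    using nn_integral_V_ge_1[OF kernel_power_prob[OF x, of n]] le[of n] by (rule order_trans)
  ultimately show False by simp
qed

lemma K_ge_1: "1 \<le> K"
proof -
  obtain x where x: "x \<in> C" using C_nonempty by blast
  have "1 \<le> ennreal K"
    using nn_integral_V_ge_1[OF kernel_prob[OF C_space[OF x]]] drift_inside[OF x] by (rule order_trans)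
  then show ?thesis by simp
qed

lemma \<epsilon>_le_1: "\<epsilon> \<le> 1"
  using C_nonempty \<epsilon>_le_1_at by blast

text \<open>The value after \<open>m\<close> steps of the recursion \<open>u \<mapsto> l u + (K - l)\<close> that has the value \<open>K\<close> after the
  first step. It bounds \<open>P\<^sup>mV\<close> on \<open>C\<close>.\<close>
definition drift_bound :: real where
  "drift_bound = (1 - l ^ m) / (1 - l) * (K - l) + l ^ m"

lemma drift_bound_ge_1: "1 \<le> drift_bound"
proof -
  have "(1 - l ^ m) / (1 - l) * (1 - l) \<le> (1 - l ^ m) / (1 - l) * (K - l)"
    using K_ge_1 l_pos l_less_1 by (intro mult_left_mono) (auto simp: power_le_one)
  then show ?thesis using l_less_1 by (simp add: drift_bound_def)
qed

lemma nn_integral_V_inside: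
  assumes x: "x \<in> C"
  shows "(\<integral>\<^sup>+z. ennreal (V z) \<partial>kernel_power M P m x) \<le> ennreal drift_bound"
proof -
  have "(\<integral>\<^sup>+z. ennreal (V z) \<partial>kernel_power M P (Suc n) x)
      \<le> ennreal ((1 - l ^ Suc n) / (1 - l) * (K - l) + l ^ Suc n)" for n
  proof (induction n)
    case 0
    then show ?case using drift_inside[OF x] kernel_power_1[OF C_space[OF x]] l_less_1 by simp
  next
    case (Suc n)
    define u where "u = (1 - l ^ Suc n) / (1 - l) * (K - l) + l ^ Suc n"
    have "0 \<le> u"
      using K_ge_1 l_pos l_less_1 unfolding u_def
      by (intro add_nonneg_nonneg mult_nonneg_nonneg divide_nonneg_nonneg) (auto simp: power_le_one simp del: power_Suc)
    moreover have "(\<integral>\<^sup>+z. ennreal (V z) \<partial>P y) \<le> ennreal (l * V y + (K - l))" if y: "y \<in> space M" for y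
    proof (cases "y \<in> C")
      case True
      have "K \<le> l * V y + (K - l)" using V_ge_1[OF y] l_pos by simp
      then show ?thesis using drift_inside[OF True] by (meson ennreal_leI order_trans)
    next
      case False
      have "l * V y \<le> l * V y + (K - l)" using K_ge_1 l_less_1 by simp
      then show ?thesis using drift_outside[OF y False] by (meson ennreal_leI order_trans)
    qed
    ultimately have "(\<integral>\<^sup>+z. ennreal (V z) \<partial>kernel_power M P (Suc (Suc n)) x) \<le> ennreal (l * u + (K - l))"
      using Suc.IH K_ge_1 l_pos l_less_1 x V_nonneg
      by (intro nn_integral_kernel_power_affine) (auto simp: u_def)
    also have "l * u + (K - l) = (1 - l ^ Suc (Suc n)) / (1 - l) * (K - l) + l ^ Suc (Suc n)"
      using l_less_1 by (simp add: u_def field_simps)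
    finally show ?case .
  qed
  from this[of "m - 1"] show ?thesis using m_pos by (simp add: drift_bound_def)
qed

lemma integrable_of_nn_integral_le:
  assumes \<mu>: "\<mu> \<in> space (prob_algebra M)" and le: "(\<integral>\<^sup>+z. ennreal (V z) \<partial>\<mu>) \<le> ennreal c" and "0 \<le> c"
  shows "integrable \<mu> V" "(\<integral>z. V z \<partial>\<mu>) \<le> c"
proof -
  have meas: "V \<in> borel_measurable \<mu>" by (rule measurable_of_prob_algebra[OF \<mu> V_measurable])
  have AE: "AE z in \<mu>. 0 \<le> V z" using V_nonneg space_of_prob_algebra[OF \<mu>] by auto
  show int: "integrable \<mu> V"
    using le by (intro integrableI_nonneg meas AE) (auto intro: le_less_trans)
  show "(\<integral>z. V z \<partial>\<mu>) \<le> c"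
    using le \<open>0 \<le> c\<close> by (simp add: nn_integral_eq_integral[OF int AE])
qed

lemma integral_V_inside:
  assumes x: "x \<in> C"
  shows "integrable (kernel_power M P m x) V" "(\<integral>z. V z \<partial>kernel_power M P m x) \<le> drift_bound"
  using integrable_of_nn_integral_le[OF kernel_power_prob[OF C_space[OF x]] nn_integral_V_inside[OF x]] drift_bound_ge_1
  by auto

lemma integral_V_outside:
  assumes x: "x \<in> space M" "x \<notin> C"
  shows "integrable (P x) V" "(\<integral>z. V z \<partial>P x) \<le> l * V x"
  using integrable_of_nn_integral_le[OF kernel_prob[OF x(1)] drift_outside[OF x]] l_pos V_nonneg[OF x(1)]
  by auto

lemma integrable_V_\<nu>: "integrable \<nu> V"
proof -
  obtain x where x: "x \<in> C" using C_nonempty by blast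
  have "ennreal \<epsilon> * (\<integral>\<^sup>+z. ennreal (V z) \<partial>\<nu>) \<le> ennreal drift_bound"
    using nn_integral_minorization[OF x, of "\<lambda>z. ennreal (V z)"] nn_integral_V_inside[OF x] V_measurable by simp
  then have "(\<integral>\<^sup>+z. ennreal (V z) \<partial>\<nu>) < \<infinity>"
    using \<epsilon>_pos by (cases "\<integral>\<^sup>+z. ennreal (V z) \<partial>\<nu>") (auto simp: ennreal_mult_top top_unique)
  then show ?thesis
    using V_nonneg space_of_prob_algebra[OF \<nu>_prob]
    by (intro integrableI_nonneg measurable_of_prob_algebra[OF \<nu>_prob V_measurable]) auto
qed

text \<open>On \<open>C\<close>, the bound on \<open>P\<^sup>mV\<close> is shared between the residual law, of mass \<open>1 - \<epsilon>\<close>, and \<open>\<epsilon>\<nu>\<close>. As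
  \<open>V \<ge> 1\<close>, each of the two parts is at least its mass, which bounds the other one; this lemma
  and the following one use the two directions.\<close>
lemma residual_V_le:
  assumes "x \<in> C" shows "residual x V \<le> drift_bound - \<epsilon>"
proof -
  interpret n: prob_space \<nu> using \<nu>_prob by (simp add: space_prob_algebra)
  have "1 \<le> (\<integral>z. V z \<partial>\<nu>)"
    using V_ge_1 space_of_prob_algebra[OF \<nu>_prob] integrable_V_\<nu> by (intro n.integral_ge_const) auto
  then have "\<epsilon> * 1 \<le> \<epsilon> * (\<integral>z. V z \<partial>\<nu>)" using \<epsilon>_pos by (intro mult_left_mono) auto
  then show ?thesis using integral_V_inside[OF assms] by (simp add: residual_def)
qed

lemma integral_V_\<nu>_le: "(\<integral>z. V z \<partial>\<nu>) \<le> (drift_bound - (1 - \<epsilon>)) / \<epsilon>"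
proof -
  obtain x where x: "x \<in> C" using C_nonempty by blast
  note k = kernel_power_prob[OF C_space[OF x], of m]
  have "residual x (\<lambda>z. 1) \<le> residual x V"
    by (rule residual_mono[OF x])
      (use integral_V_inside(1)[OF x] integrable_V_\<nu> V_ge_1 V_measurable in
        \<open>simp_all add: integrable_at_C[OF x]\<close>)
  then have "1 - \<epsilon> \<le> drift_bound - \<epsilon> * (\<integral>z. V z \<partial>\<nu>)"
    using integral_V_inside[OF x] x by (simp add: residual_const) (simp add: residual_def)
  then show ?thesis using \<epsilon>_pos by (simp add: field_simps)
qed

end

section \<open>Renewal equations and the cycle formula\<close>

lemma fps_mult_nth_atMost: "fps_nth (Abs_fps a * Abs_fps b) n = (\<Sum>k\<le>n. a k * b (n - k))"
  by (simp add: fps_mult_nth atMost_atLeast0)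

text \<open>In terms of generating functions the hypotheses read \<open>W = A W + G\<close>, \<open>A E = E - Q\<close> and
  \<open>V = A' W + Z\<close>, where \<open>E\<close> is the series with all coefficients \<open>1\<close>. Multiplying the first equation by
  \<open>E\<close> gives \<open>Q W = G E\<close>; the second claim is the third equation multiplied by \<open>Q\<close>.\<close>
lemma delayed_renewal_sum:
  fixes a a' q v w g z :: "nat \<Rightarrow> real"
  assumes w: "\<And>n. w n = (\<Sum>k\<le>n. a k * w (n - k)) + g n"
    and q: "\<And>n. (\<Sum>k\<le>n. a k) = 1 - q n"
    and v: "\<And>n. v n = (\<Sum>k\<le>n. a' k * w (n - k)) + z n"
  shows "(\<Sum>k\<le>n. q k * w (n - k)) = (\<Sum>k\<le>n. g k)"
    and "(\<Sum>k\<le>n. q k * v (n - k)) =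
      (\<Sum>k\<le>n. a' k * (\<Sum>j\<le>n - k. g j)) + (\<Sum>k\<le>n. q k * z (n - k))"
proof -
  define W A A' G Q V Z E where
    "W = Abs_fps w" and "A = Abs_fps a" and "A' = Abs_fps a'" and "G = Abs_fps g" and
    "Q = Abs_fps q" and "V = Abs_fps v" and "Z = Abs_fps z" and "E = Abs_fps (\<lambda>_. 1::real)"
  note defs = W_def A_def A'_def G_def Q_def V_def Z_def E_def
  have "W = A * W + G" "V = A' * W + Z" "A * E = E - Q"
    by (rule fps_ext; simp add: defs fps_mult_nth_atMost q flip: w v)+
  then have "E * (A * W + G) = E * W" "A * E = E - Q" by simp_all
  then have QW: "Q * W = G * E" by algebra
  show "(\<Sum>k\<le>n. q k * w (n - k)) = (\<Sum>k\<le>n. g k)"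
    using arg_cong[OF QW, of "\<lambda>F. fps_nth F n"] by (simp add: defs fps_mult_nth_atMost)
  have "Q * V = A' * (G * E) + Q * Z"
    unfolding \<open>V = A' * W + Z\<close> QW[symmetric] by (simp add: algebra_simps)
  moreover have "G * E = Abs_fps (\<lambda>n. \<Sum>j\<le>n. g j)"
    by (rule fps_ext) (simp add: defs fps_mult_nth_atMost)
  ultimately have "Q * V = A' * Abs_fps (\<lambda>n. \<Sum>j\<le>n. g j) + Q * Z" by simp
  from arg_cong[OF this, of "\<lambda>F. fps_nth F n"]
  show "(\<Sum>k\<le>n. q k * v (n - k)) =
      (\<Sum>k\<le>n. a' k * (\<Sum>j\<le>n - k. g j)) + (\<Sum>k\<le>n. q k * z (n - k))"
    by (simp add: defs fps_mult_nth_atMost)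
qed

lemma tendsto_convolution:
  fixes a b :: "nat \<Rightarrow> real"
  assumes a: "summable (\<lambda>k. \<bar>a k\<bar>)" and b: "b \<longlonglongrightarrow> L"
  shows "(\<lambda>n. \<Sum>k\<le>n. a k * b (n - k)) \<longlonglongrightarrow> (\<Sum>k. a k) * L"
proof -
  obtain c where c: "\<And>n. \<bar>b n\<bar> \<le> c"
    using convergent_imp_Bseq[of b] b by (auto simp: convergent_def Bseq_def)
  define f where "f k n = (if k \<le> n then a k * b (n - k) else 0)" for k n
  have "(\<lambda>n. \<Sum>k. f k n) \<longlonglongrightarrow> (\<Sum>k. a k * L)"
  proof (rule tannerys_theorem[THEN conjunct2, THEN conjunct2])
    show "(\<lambda>n. f k n) \<longlonglongrightarrow> a k * L" for k
    proof (rule Lim_transform_eventually)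
      show "(\<lambda>n. a k * b (n - k)) \<longlonglongrightarrow> a k * L"
        using LIMSEQ_offset[of "\<lambda>n. b (n - k)" k L] b by (intro tendsto_mult) auto
      show "\<forall>\<^sub>F n in sequentially. a k * b (n - k) = f k n"
        using eventually_ge_at_top[of k] by eventually_elim (simp add: f_def)
    qed
    have "norm (f k n) \<le> \<bar>a k\<bar> * c" for k n
      using mult_left_mono[OF c, of "\<bar>a k\<bar>"] order_trans[OF abs_ge_zero c]
      by (auto simp: f_def abs_mult)
    then show "\<forall>\<^sub>F (k, n) in sequentially \<times>\<^sub>F sequentially. norm (f k n) \<le> \<bar>a k\<bar> * c"
      by (intro always_eventually) auto
    show "summable (\<lambda>k. \<bar>a k\<bar> * c)" using a by (rule summable_mult2)
  qed simp
  moreover have "(\<Sum>k. f k n) = (\<Sum>k\<le>n. a k * b (n - k))" for n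
    by (subst suminf_finite[of "{..n}"]) (auto simp: f_def)
  moreover have "summable a" using a by (rule summable_rabs_cancel)
  ultimately show ?thesis by (simp add: suminf_mult2)
qed

locale regenerative_chain = minorized_chain +
  fixes \<pi> :: "'a measure"
  assumes \<pi>_prob [simp]: "\<pi> \<in> space (prob_algebra M)"
    and stationary: "f \<in> bounded_measurable M \<Longrightarrow> (\<integral>x. T f x \<partial>\<pi>) = (\<integral>x. f x \<partial>\<pi>)"
    and surv_tendsto_0: "x \<in> space M \<Longrightarrow> (\<lambda>n. surv n (\<lambda>y. 1) x) \<longlonglongrightarrow> 0"
    and summable_surv_\<nu>: "summable (\<lambda>n. \<integral>x. surv n (\<lambda>y. 1) x \<partial>\<nu>)"
begin

definition tail :: "nat \<Rightarrow> real" where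
  "tail n = (\<integral>x. surv n (\<lambda>y. 1) x \<partial>\<nu>)"

text \<open>The expectation of the regeneration time of the chain started from \<open>\<nu>\<close>.\<close>
definition mean_return :: real where
  "mean_return = (\<Sum>n. tail n)"

lemma integral_renewal_decomposition:
  assumes \<mu>: "\<mu> \<in> space (prob_algebra M)" and f: "f \<in> bounded_measurable M"
  shows "(\<integral>x. (T ^^ n) f x \<partial>\<mu>) =
    (\<Sum>k\<le>n. (\<integral>x. regen k x \<partial>\<mu>) * (\<integral>y. (T ^^ (n - k)) f y \<partial>\<nu>)) + (\<integral>x. surv n f x \<partial>\<mu>)"
proof -
  have "(\<integral>x. (T ^^ n) f x \<partial>\<mu>) =
      (\<integral>x. ((\<Sum>k\<le>n. regen k x * (\<integral>y. (T ^^ (n - k)) f y \<partial>\<nu>)) + surv n f x) \<partial>\<mu>)"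
    using renewal_decomposition[OF f] by (intro integral_cong_prob_algebra[OF \<mu>]) auto
  also have "\<dots> = (\<Sum>k\<le>n. (\<integral>x. regen k x \<partial>\<mu>) * (\<integral>y. (T ^^ (n - k)) f y \<partial>\<nu>)) + (\<integral>x. surv n f x \<partial>\<mu>)"
    using f by (intro integral_lin_comb[OF \<mu>]) auto
  finally show ?thesis .
qed

lemma sum_integral_regen:
  assumes \<mu>: "\<mu> \<in> space (prob_algebra M)"
  shows "(\<Sum>k\<le>n. \<integral>x. regen k x \<partial>\<mu>) = 1 - (\<integral>x. surv n (\<lambda>y. 1) x \<partial>\<mu>)"
proof -
  have "(\<Sum>k\<le>n. \<integral>x. regen k x \<partial>\<mu>) = (\<integral>x. (\<Sum>k\<le>n. regen k x) \<partial>\<mu>)"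
    using integrable_bounded_measurable[OF \<mu> regen_bounded_measurable]
    by (simp add: Bochner_Integration.integral_sum)
  also have "\<dots> = (\<integral>x. 1 - surv n (\<lambda>y. 1) x \<partial>\<mu>)"
    by (intro integral_cong_prob_algebra[OF \<mu>] sum_regen)
  also have "\<dots> = 1 - (\<integral>x. surv n (\<lambda>y. 1) x \<partial>\<mu>)"
    using integrable_bounded_measurable[OF \<mu>] measure_space_prob_algebra[OF \<mu>] by simp
  finally show ?thesis .
qed

lemma abs_integral_surv_le:
  assumes \<mu>: "\<mu> \<in> space (prob_algebra M)" and f: "f \<in> bounded_measurable M"
    and c: "\<And>y. y \<in> space M \<Longrightarrow> \<bar>f y\<bar> \<le> c"
  shows "\<bar>\<integral>x. surv n f x \<partial>\<mu>\<bar> \<le> c * (\<integral>x. surv n (\<lambda>y. 1) x \<partial>\<mu>)"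
proof -
  have "\<bar>\<integral>x. surv n f x \<partial>\<mu>\<bar> \<le> (\<integral>x. \<bar>surv n f x\<bar> \<partial>\<mu>)"
    by (rule integral_abs_bound)
  also have "\<dots> \<le> (\<integral>x. c * surv n (\<lambda>y. 1) x \<partial>\<mu>)"
    using abs_surv_le[OF f c] space_of_prob_algebra[OF \<mu>]
      integrable_bounded_measurable[OF \<mu> surv_bounded_measurable[OF f]]
      integrable_bounded_measurable[OF \<mu> surv_bounded_measurable[OF bounded_measurable_const[of 1]]]
    by (intro integral_mono) auto
  finally show ?thesis by simp
qed

lemma integral_surv_nonneg:
  assumes \<mu>: "\<mu> \<in> space (prob_algebra M)" and f: "f \<in> bounded_measurable M"
    and "\<And>y. y \<in> space M \<Longrightarrow> 0 \<le> f y"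
  shows "0 \<le> (\<integral>x. surv n f x \<partial>\<mu>)"
  using surv_nonneg[OF f assms(3)] by (intro integral_bounded_measurable_nonneg[OF \<mu>])

lemma tail_nonneg: "0 \<le> tail n"
  unfolding tail_def by (rule integral_surv_nonneg) auto

lemma tail_0: "tail 0 = 1"
  using measure_space_prob_algebra[OF \<nu>_prob] by (simp add: tail_def)

lemma renewal_equation_sum:
  assumes "f \<in> bounded_measurable M"
  shows "(\<Sum>k\<le>n. tail k * (\<integral>y. (T ^^ (n - k)) f y \<partial>\<nu>)) = (\<Sum>k\<le>n. \<integral>y. surv k f y \<partial>\<nu>)"
  unfolding tail_def
  by (rule delayed_renewal_sum(1)[where w = "\<lambda>n. \<integral>y. (T ^^ n) f y \<partial>\<nu>" and
        v = "\<lambda>n. \<integral>y. (T ^^ n) f y \<partial>\<nu>"])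
    (rule integral_renewal_decomposition[OF \<nu>_prob assms] sum_integral_regen[OF \<nu>_prob])+

lemma integral_surv_\<pi>_tendsto_0: "(\<lambda>n. \<integral>x. surv n (\<lambda>y. 1) x \<partial>\<pi>) \<longlonglongrightarrow> 0"
proof -
  interpret pi: prob_space \<pi> using \<pi>_prob by (simp add: space_prob_algebra)
  have "(\<lambda>n. \<integral>x. surv n (\<lambda>y. 1) x \<partial>\<pi>) \<longlonglongrightarrow> (\<integral>x. 0 \<partial>\<pi>)"
  proof (rule integral_dominated_convergence[where w = "\<lambda>x. 1"])
    show "surv n (\<lambda>y. 1) \<in> borel_measurable \<pi>" for n
      by (rule measurable_of_prob_algebra[OF \<pi>_prob]) (simp add: bounded_measurable_measurable)
    show "AE x in \<pi>. norm (surv n (\<lambda>y. 1) x) \<le> 1" for n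
      using surv_one_le_1 surv_nonneg[of "\<lambda>y. 1"] space_of_prob_algebra[OF \<pi>_prob] by auto
    show "AE x in \<pi>. (\<lambda>n. surv n (\<lambda>y. 1) x) \<longlonglongrightarrow> 0"
      using surv_tendsto_0 space_of_prob_algebra[OF \<pi>_prob] by auto
  qed auto
  then show ?thesis by simp
qed

lemma integral_T_power_\<pi>: "f \<in> bounded_measurable M \<Longrightarrow> (\<integral>x. (T ^^ n) f x \<partial>\<pi>) = (\<integral>x. f x \<partial>\<pi>)"
  by (induction n) (simp_all add: stationary)

text \<open>The expected occupation measure of the chain started from \<open>\<nu>\<close> and stopped at its regeneration is
  \<open>E\<^sub>\<nu> \<tau>\<close> times \<open>\<pi>\<close>. Start the chain from \<open>\<pi>\<close>, where the expectation of \<open>f(X\<^sub>n)\<close> does not depend on \<open>n\<close>,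
  and convolve its renewal equation with the tail of \<open>\<tau>\<close> under \<open>\<nu>\<close>. The left-hand side tends to
  \<open>E\<^sub>\<nu> \<tau> \<cdot> \<pi>(f)\<close>. The right-hand side tends to the occupation sum because under \<open>\<pi>\<close> regeneration
  happens almost surely in finite time.\<close>
theorem cycle_formula:
  assumes f: "f \<in> bounded_measurable M"
  shows "(\<lambda>n. \<integral>y. surv n f y \<partial>\<nu>) sums (mean_return * (\<integral>x. f x \<partial>\<pi>))"
proof -
  define g where "g n = (\<integral>y. surv n f y \<partial>\<nu>)" for n
  define a' where "a' k = (\<integral>x. regen k x \<partial>\<pi>)" for k
  define z where "z n = (\<integral>x. surv n f x \<partial>\<pi>)" for n
  obtain c where c: "\<forall>y\<in>space M. \<bar>f y\<bar> \<le> c" using bounded_measurable_bound[OF f] by blast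
  have tail_summable: "summable tail"
    using summable_surv_\<nu> by (simp add: tail_def[abs_def])
  have g: "summable g"
  proof (rule summable_comparison_test'[of "\<lambda>n. c * tail n"])
    show "summable (\<lambda>n. c * tail n)" using tail_summable by (rule summable_mult)
    show "norm (g n) \<le> c * tail n" for n
      using abs_integral_surv_le[OF \<nu>_prob f] c by (simp add: g_def tail_def)
  qed
  have a'_nonneg: "0 \<le> a' k" for k
    unfolding a'_def by (rule integral_bounded_measurable_nonneg[OF \<pi>_prob regen_nonneg])
  have "(\<lambda>n. \<Sum>k\<le>n. a' k) \<longlonglongrightarrow> 1 - 0"
    unfolding a'_def sum_integral_regen[OF \<pi>_prob]
    by (intro tendsto_diff tendsto_const integral_surv_\<pi>_tendsto_0)
  then have a'_sums: "a' sums 1" by (simp add: sums_def_le)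
  have z: "z \<longlonglongrightarrow> 0"
  proof (rule Lim_null_comparison)
    show "\<forall>\<^sub>F n in sequentially. norm (z n) \<le> c * (\<integral>x. surv n (\<lambda>y. 1) x \<partial>\<pi>)"
      using abs_integral_surv_le[OF \<pi>_prob f] c by (simp add: z_def)
    show "(\<lambda>n. c * (\<integral>x. surv n (\<lambda>y. 1) x \<partial>\<pi>)) \<longlonglongrightarrow> 0"
      using tendsto_mult_right_zero[OF integral_surv_\<pi>_tendsto_0] .
  qed
  have id: "(\<Sum>k\<le>n. tail k * (\<integral>x. f x \<partial>\<pi>)) =
      (\<Sum>k\<le>n. a' k * (\<Sum>j\<le>n - k. g j)) + (\<Sum>k\<le>n. tail k * z (n - k))" for n
  proof (rule delayed_renewal_sum(2)[where w = "\<lambda>n. \<integral>y. (T ^^ n) f y \<partial>\<nu>" and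
        v = "\<lambda>n. \<integral>x. f x \<partial>\<pi>" and a = "\<lambda>k. \<integral>x. regen k x \<partial>\<nu>"])
    show "(\<integral>x. f x \<partial>\<pi>) = (\<Sum>k\<le>n. a' k * (\<integral>y. (T ^^ (n - k)) f y \<partial>\<nu>)) + z n" for n
      using integral_renewal_decomposition[OF \<pi>_prob f, of n] integral_T_power_\<pi>[OF f]
      by (simp add: a'_def z_def)
    show "(\<integral>y. (T ^^ n) f y \<partial>\<nu>) =
        (\<Sum>k\<le>n. (\<integral>x. regen k x \<partial>\<nu>) * (\<integral>y. (T ^^ (n - k)) f y \<partial>\<nu>)) + g n" for n
      unfolding g_def by (rule integral_renewal_decomposition[OF \<nu>_prob f])
    show "(\<Sum>k\<le>n. \<integral>x. regen k x \<partial>\<nu>) = 1 - tail n" for n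
      unfolding tail_def by (rule sum_integral_regen[OF \<nu>_prob])
  qed
  have "(\<lambda>n. \<Sum>k\<le>n. tail k * (\<integral>x. f x \<partial>\<pi>)) \<longlonglongrightarrow> mean_return * (\<integral>x. f x \<partial>\<pi>)"
    using sums_mult2[OF summable_sums[OF tail_summable]] by (simp add: sums_def_le mean_return_def)
  moreover have "(\<lambda>n. \<Sum>k\<le>n. tail k * (\<integral>x. f x \<partial>\<pi>)) \<longlonglongrightarrow> (\<Sum>k. a' k) * suminf g + (\<Sum>k. tail k) * 0"
    unfolding id
    using a'_sums tail_summable summable_LIMSEQ'[OF g] z a'_nonneg tail_nonneg
    by (intro tendsto_add tendsto_convolution) (simp_all add: sums_iff)
  ultimately have "mean_return * (\<integral>x. f x \<partial>\<pi>) = suminf g"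
    using LIMSEQ_unique sums_unique[OF a'_sums] by fastforce
  then show ?thesis
    using summable_sums[OF g] by (simp add: g_def[abs_def])
qed

end

section \<open>Reversibility and positivity\<close>

lemma nonneg_quadratic_imp_discriminant:
  fixes a b c :: real
  assumes "\<And>t. 0 \<le> a + 2 * b * t + c * t\<^sup>2" "0 \<le> c"
  shows "b\<^sup>2 \<le> a * c"
proof (cases "c = 0")
  case True
  have "b = 0"
  proof (rule ccontr)
    assume "b \<noteq> 0"
    then show False using assms(1)[of "- (a + 1) / (2 * b)"] True by (simp add: field_simps)
  qed
  then show ?thesis using True by simp
next
  case False
  then have "0 < c" using assms(2) by simp
  then show ?thesis
    using assms(1)[of "- b / c"] by (simp add: field_simps power2_eq_square)
qed

text \<open>The constant \<open>c\<close> can be improved to \<open>w 0\<close>: if \<open>y = w n / (w 0 \<rho>\<^sup>n)\<close> exceeded \<open>1\<close>, then iterated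
  doubling would give \<open>w (2 ^ k * n) \<ge> w 0 * y ^ (2 ^ k) * \<rho> ^ (2 ^ k * n)\<close>, in conflict with the bound by \<open>c\<close>.\<close>
lemma geometric_decay_of_doubling:
  fixes w :: "nat \<Rightarrow> real"
  assumes nonneg: "\<And>n. 0 \<le> w n" and doubling: "\<And>n. (w n)\<^sup>2 \<le> w 0 * w (2 * n)"
    and decay: "\<And>n. w n \<le> c * \<rho> ^ n" and "0 < \<rho>"
  shows "w n \<le> \<rho> ^ n * w 0"
proof (cases "w 0 = 0")
  case True
  then show ?thesis using doubling[of n] by simp
next
  case False
  then have w0: "0 < w 0" using nonneg[of 0] by simp
  define y where "y = w n / (w 0 * \<rho> ^ n)"
  have y0: "0 \<le> y" using nonneg \<open>0 < \<rho>\<close> by (simp add: y_def)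
  have lower: "w 0 * (y * \<rho> ^ n) ^ (2 ^ k) \<le> w (2 ^ k * n)" for k
  proof (induction k)
    case 0
    then show ?case using w0 \<open>0 < \<rho>\<close> by (simp add: y_def)
  next
    case (Suc k)
    have "(w 0 * (y * \<rho> ^ n) ^ (2 ^ k))\<^sup>2 \<le> (w (2 ^ k * n))\<^sup>2"
      using Suc w0 y0 \<open>0 < \<rho>\<close> by (intro power_mono) auto
    also have "\<dots> \<le> w 0 * w (2 ^ Suc k * n)"
      using doubling[of "2 ^ k * n"] by (simp add: mult.assoc)
    finally have "w 0 * (w 0 * (y * \<rho> ^ n) ^ (2 ^ Suc k)) \<le> w 0 * w (2 ^ Suc k * n)"
      by (simp add: power2_eq_square power_mult_distrib power_add mult_2 algebra_simps)
    then show ?case using w0 by simp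
  qed
  have "y ^ (2 ^ k) \<le> c / w 0" for k
  proof -
    have "w 0 * y ^ (2 ^ k) * \<rho> ^ (2 ^ k * n) \<le> c * \<rho> ^ (2 ^ k * n)"
      using order_trans[OF lower decay, of k]
      by (simp add: power_mult_distrib power_mult[symmetric] mult.commute mult.left_commute)
    then show ?thesis using w0 \<open>0 < \<rho>\<close> by (simp add: field_simps)
  qed
  note upper = this
  have "y \<le> 1"
  proof (rule ccontr)
    assume "\<not> y \<le> 1"
    then have "1 < y" by simp
    then obtain k where "c / w 0 < y ^ k" using real_arch_pow by blast
    also have "\<dots> \<le> y ^ (2 ^ k)" using \<open>1 < y\<close> by (intro power_increasing) (auto intro: less_imp_le less_exp)
    finally show False using upper[of k] by simp
  qed
  then show ?thesis using w0 \<open>0 < \<rho>\<close> by (simp add: y_def field_simps)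
qed

locale reversible_chain = markov_chain +
  fixes \<pi> :: "'a measure"
  assumes \<pi>_prob [simp]: "\<pi> \<in> space (prob_algebra M)" and rev: "reversible M \<pi> P"
begin

definition inner_prod :: "('a \<Rightarrow> real) \<Rightarrow> ('a \<Rightarrow> real) \<Rightarrow> real" where
  "inner_prod f g = (\<integral>x. f x * g x \<partial>\<pi>)"

lemma integral_joint_law:
  assumes h: "h \<in> bounded_measurable (M \<Otimes>\<^sub>M M)"
  shows "(\<integral>z. h z \<partial>joint_law M \<pi> P) = (\<integral>x. \<integral>y. h (x, y) \<partial>P x \<partial>\<pi>)"
proof -
  note kernel[measurable]
  have "(\<lambda>x. P x \<bind> (\<lambda>y. return (M \<Otimes>\<^sub>M M) (x, y))) \<in> M \<rightarrow>\<^sub>M prob_algebra (M \<Otimes>\<^sub>M M)"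
    by measurable
  then have "(\<integral>z. h z \<partial>joint_law M \<pi> P) =
      (\<integral>x. \<integral>z. h z \<partial>(P x \<bind> (\<lambda>y. return (M \<Otimes>\<^sub>M M) (x, y))) \<partial>\<pi>)"
    unfolding joint_law_def using h by (intro integral_bind_prob[OF \<pi>_prob])
  also have "\<dots> = (\<integral>x. \<integral>y. h (x, y) \<partial>P x \<partial>\<pi>)"
  proof (rule integral_cong_prob_algebra[OF \<pi>_prob])
    fix x assume x[measurable]: "x \<in> space M"
    have "(\<lambda>y. return (M \<Otimes>\<^sub>M M) (x, y)) \<in> M \<rightarrow>\<^sub>M prob_algebra (M \<Otimes>\<^sub>M M)"
      by measurable
    then have "(\<integral>z. h z \<partial>(P x \<bind> (\<lambda>y. return (M \<Otimes>\<^sub>M M) (x, y)))) =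
        (\<integral>y. \<integral>z. h z \<partial>return (M \<Otimes>\<^sub>M M) (x, y) \<partial>P x)"
      using h by (intro integral_bind_prob[OF kernel_prob[OF x]])
    also have "\<dots> = (\<integral>y. h (x, y) \<partial>P x)"
      using h x by (intro integral_cong_prob_algebra[OF kernel_prob[OF x]] integral_return)
        (auto simp: space_pair_measure bounded_measurable_measurable)
    finally show "(\<integral>z. h z \<partial>(P x \<bind> (\<lambda>y. return (M \<Otimes>\<^sub>M M) (x, y)))) = (\<integral>y. h (x, y) \<partial>P x)" .
  qed
  finally show ?thesis .
qed

lemma sets_joint_law: "sets (joint_law M \<pi> P) = sets (M \<Otimes>\<^sub>M M)"
proof -
  note kernel[measurable]
  have "(\<lambda>x. P x \<bind> (\<lambda>y. return (M \<Otimes>\<^sub>M M) (x, y))) \<in> M \<rightarrow>\<^sub>M prob_algebra (M \<Otimes>\<^sub>M M)"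
    by measurable
  then show ?thesis unfolding joint_law_def by (rule sets_bind'[OF \<pi>_prob])
qed

lemma inner_prod_commute: "inner_prod f g = inner_prod g f"
  by (simp add: inner_prod_def mult.commute)

text \<open>Integrate \<open>f(x) g(y)\<close> against the symmetric measure \<open>\<pi>(dx) P(x,dy)\<close>.\<close>
lemma inner_prod_T_symmetric:
  assumes f: "f \<in> bounded_measurable M" and g: "g \<in> bounded_measurable M"
  shows "inner_prod f (T g) = inner_prod (T f) g"
proof -
  have bm: "(\<lambda>(x, y). f x * g y) \<in> bounded_measurable (M \<Otimes>\<^sub>M M)"
    if f: "f \<in> bounded_measurable M" and g: "g \<in> bounded_measurable M" for f g
  proof -
    obtain c d where "0 \<le> c" "0 \<le> d" "\<forall>x\<in>space M. \<bar>f x\<bar> \<le> c" "\<forall>x\<in>space M. \<bar>g x\<bar> \<le> d"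
      using bounded_measurable_bound[OF f] bounded_measurable_bound[OF g] by blast
    moreover have "(\<lambda>(x, y). f x * g y) \<in> borel_measurable (M \<Otimes>\<^sub>M M)"
      using bounded_measurable_measurable[OF f] bounded_measurable_measurable[OF g] by measurable
    ultimately show ?thesis
      by (intro bounded_measurableI[of _ _ "c * d"]) (auto simp: space_pair_measure abs_mult intro!: mult_mono)
  qed
  have inner_prod: "inner_prod f (T g) = (\<integral>z. (case z of (x, y) \<Rightarrow> f x * g y) \<partial>joint_law M \<pi> P)"
    if f: "f \<in> bounded_measurable M" and g: "g \<in> bounded_measurable M" for f g
    using integral_joint_law[OF bm[OF f g]] by (simp add: inner_prod_def kernel_op_def)
  have "inner_prod f (T g) = (\<integral>z. (case z of (x, y) \<Rightarrow> f x * g y) \<partial>distr (joint_law M \<pi> P) (M \<Otimes>\<^sub>M M) (\<lambda>(x, y). (y, x)))"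
    using inner_prod[OF f g] rev by (simp add: reversible_def)
  also have "\<dots> = (\<integral>z. (case z of (x, y) \<Rightarrow> g x * f y) \<partial>joint_law M \<pi> P)"
  proof (subst integral_distr)
    show "(\<lambda>(x, y). (y, x)) \<in> joint_law M \<pi> P \<rightarrow>\<^sub>M M \<Otimes>\<^sub>M M"
      unfolding measurable_cong_sets[OF sets_joint_law refl] by measurable
    show "(\<lambda>(x, y). f x * g y) \<in> borel_measurable (M \<Otimes>\<^sub>M M)"
      using bm[OF f g] by (rule bounded_measurable_measurable)
  qed (simp add: case_prod_unfold mult.commute)
  also have "\<dots> = inner_prod g (T f)" using inner_prod[OF g f] by simp
  finally show ?thesis by (simp add: inner_prod_commute)
qed

lemma integral_T_\<pi>:
  assumes "f \<in> bounded_measurable M"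
  shows "(\<integral>x. T f x \<partial>\<pi>) = (\<integral>x. f x \<partial>\<pi>)"
proof -
  have "inner_prod (T (\<lambda>x. 1)) f = inner_prod (\<lambda>x. 1) f"
    unfolding inner_prod_def using measure_space_prob_algebra[OF kernel_prob]
    by (intro integral_cong_prob_algebra[OF \<pi>_prob]) (simp add: kernel_op_def)
  then show ?thesis
    using inner_prod_T_symmetric[of "\<lambda>x. 1" f] assms by (simp add: inner_prod_def)
qed

lemma inner_prod_add_right:
  "f \<in> bounded_measurable M \<Longrightarrow> g \<in> bounded_measurable M \<Longrightarrow> h \<in> bounded_measurable M \<Longrightarrow>
    inner_prod f (\<lambda>x. g x + c * h x) = inner_prod f g + c * inner_prod f h"
  using integrable_bounded_measurable[OF \<pi>_prob bounded_measurable_mult[of f M g]]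
    integrable_bounded_measurable[OF \<pi>_prob bounded_measurable_mult[of f M h]]
  by (simp add: inner_prod_def distrib_left mult.left_commute)

lemma inner_prod_add_left:
  "f \<in> bounded_measurable M \<Longrightarrow> g \<in> bounded_measurable M \<Longrightarrow> h \<in> bounded_measurable M \<Longrightarrow>
    inner_prod (\<lambda>x. g x + c * h x) f = inner_prod g f + c * inner_prod h f"
  using inner_prod_add_right[of f g h c] by (simp add: inner_prod_commute)

lemma inner_prod_nonneg: "0 \<le> inner_prod f f"
  by (simp add: inner_prod_def)

lemma inner_prod_Cauchy_Schwarz:
  assumes "f \<in> bounded_measurable M" "g \<in> bounded_measurable M"
  shows "(inner_prod f g)\<^sup>2 \<le> inner_prod f f * inner_prod g g"
proof (rule nonneg_quadratic_imp_discriminant)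
  fix t
  have "0 \<le> inner_prod (\<lambda>x. f x + t * g x) (\<lambda>x. f x + t * g x)" by (rule inner_prod_nonneg)
  also have "\<dots> = inner_prod f f + 2 * inner_prod f g * t + inner_prod g g * t\<^sup>2"
    using assms by (simp add: inner_prod_add_left inner_prod_add_right inner_prod_commute[of g f] power2_eq_square algebra_simps)
  finally show "0 \<le> inner_prod f f + 2 * inner_prod f g * t + inner_prod g g * t\<^sup>2" .
qed (rule inner_prod_nonneg)

lemma T_square_le:
  assumes f: "f \<in> bounded_measurable M" and x: "x \<in> space M"
  shows "(T f x)\<^sup>2 \<le> T (\<lambda>y. f y * f y) x"
proof -
  note int = integrable_bounded_measurable[OF kernel_prob[OF x] f]
    integrable_bounded_measurable[OF kernel_prob[OF x] bounded_measurable_mult[OF f f]]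
  define a where "a = T f x"
  have "0 \<le> (\<integral>y. (f y - a)\<^sup>2 \<partial>P x)" by simp
  also have "\<dots> = (\<integral>y. (f y * f y - 2 * a * f y) + a * a \<partial>P x)"
    by (simp add: power2_eq_square algebra_simps)
  also have "\<dots> = T (\<lambda>y. f y * f y) x - 2 * a * a + a * a"
    using int measure_space_prob_algebra[OF kernel_prob[OF x]]
      integrable_bounded_measurable[OF kernel_prob[OF x] bounded_measurable_const[of "a * a"]]
    by (simp add: a_def kernel_op_def)
  finally show ?thesis by (simp add: a_def power2_eq_square)
qed

lemma inner_prod_T_contraction:
  assumes f: "f \<in> bounded_measurable M"
  shows "inner_prod (T f) (T f) \<le> inner_prod f f"
proof -
  have "inner_prod (T f) (T f) \<le> (\<integral>x. T (\<lambda>y. f y * f y) x \<partial>\<pi>)"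
    unfolding inner_prod_def using T_square_le[OF f] f
    by (intro integral_mono_bounded_measurable[OF \<pi>_prob]) (auto simp: power2_eq_square)
  also have "\<dots> = inner_prod f f" using f by (simp add: integral_T_\<pi> inner_prod_def)
  finally show ?thesis .
qed

lemma abs_inner_prod_T_le:
  assumes f: "f \<in> bounded_measurable M"
  shows "\<bar>inner_prod f (T f)\<bar> \<le> inner_prod f f"
proof -
  have "(inner_prod f (T f))\<^sup>2 \<le> inner_prod f f * inner_prod (T f) (T f)"
    using f by (intro inner_prod_Cauchy_Schwarz) auto
  also have "\<dots> \<le> inner_prod f f * inner_prod f f"
    using inner_prod_T_contraction[OF f] by (intro mult_left_mono inner_prod_nonneg)
  finally have "(inner_prod f (T f))\<^sup>2 \<le> (inner_prod f f)\<^sup>2" by (simp add: power2_eq_square)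
  then have "\<bar>inner_prod f (T f)\<bar> \<le> \<bar>inner_prod f f\<bar>" by (simp only: abs_le_square_iff)
  then show ?thesis using inner_prod_nonneg[of f] by simp
qed

lemma T_linear:
  assumes "g \<in> bounded_measurable M" "h \<in> bounded_measurable M" "x \<in> space M"
  shows "T (\<lambda>y. g y + t * h y) x = T g x + t * T h x"
  using integrable_bounded_measurable[OF kernel_prob[OF assms(3)] assms(1)]
    integrable_bounded_measurable[OF kernel_prob[OF assms(3)] assms(2)]
  by (simp add: kernel_op_def)

lemma T_cmult: "T (\<lambda>y. c * f y) = (\<lambda>x. c * T f x)"
  by (simp add: kernel_op_def)

lemma inner_prod_cmult: "inner_prod (\<lambda>x. c * f x) (\<lambda>x. c * g x) = c\<^sup>2 * inner_prod f g"
proof -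
  have "(\<lambda>x. c * f x * (c * g x)) = (\<lambda>x. c\<^sup>2 * (f x * g x))"
    by (simp add: fun_eq_iff power2_eq_square)
  then show ?thesis by (simp add: inner_prod_def)
qed

lemma inner_prod_cong_right: "(\<And>x. x \<in> space M \<Longrightarrow> g x = h x) \<Longrightarrow> inner_prod f g = inner_prod f h"
  unfolding inner_prod_def by (intro integral_cong_prob_algebra[OF \<pi>_prob]) auto

text \<open>The Cauchy-Schwarz inequality for the form \<open>\<langle>f, (T + c) g\<rangle>\<close>, which is used with \<open>- c\<close> equal to the
  infimum of the Rayleigh quotient.\<close>
lemma inner_prod_T_Cauchy_Schwarz:
  assumes psd: "\<And>f. f \<in> bounded_measurable M \<Longrightarrow> 0 \<le> inner_prod f (T f) + c * inner_prod f f"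
    and g: "g \<in> bounded_measurable M" and h: "h \<in> bounded_measurable M"
  shows "(inner_prod g (T h) + c * inner_prod g h)\<^sup>2 \<le> (inner_prod g (T g) + c * inner_prod g g) * (inner_prod h (T h) + c * inner_prod h h)"
proof (rule nonneg_quadratic_imp_discriminant)
  fix t
  define u where "u x = g x + t * h x" for x
  have u: "u \<in> bounded_measurable M"
    unfolding u_def using g h by (intro bounded_measurable_add bounded_measurable_mult) auto
  have "inner_prod u (T u) = inner_prod u (\<lambda>x. T g x + t * T h x)"
    by (rule inner_prod_cong_right) (simp add: u_def[abs_def] T_linear g h)
  also have "\<dots> = inner_prod g (T g) + 2 * t * inner_prod g (T h) + t\<^sup>2 * inner_prod h (T h)"
    using g h u inner_prod_T_symmetric[OF g h] inner_prod_commute[of "T g" h]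
    by (simp add: inner_prod_add_right) (simp add: u_def[abs_def] inner_prod_add_left power2_eq_square algebra_simps)
  finally have 1: "inner_prod u (T u) = inner_prod g (T g) + 2 * t * inner_prod g (T h) + t\<^sup>2 * inner_prod h (T h)" .
  have "inner_prod u u = inner_prod u g + t * inner_prod u h"
    unfolding u_def using g h u[unfolded u_def[abs_def]] by (intro inner_prod_add_right)
  also have "\<dots> = inner_prod g g + 2 * t * inner_prod g h + t\<^sup>2 * inner_prod h h"
    unfolding u_def using g h inner_prod_commute[of h g]
    by (simp add: inner_prod_add_left power2_eq_square algebra_simps)
  finally show "0 \<le> (inner_prod g (T g) + c * inner_prod g g) + 2 * (inner_prod g (T h) + c * inner_prod g h) * t +
      (inner_prod h (T h) + c * inner_prod h h) * t\<^sup>2"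
    using psd[OF u] 1 by (simp add: algebra_simps)
qed (rule psd[OF h])

lemma bounded_measurable_L2_funs:
  assumes "f \<in> bounded_measurable M"
  shows "f \<in> L2_funs \<pi>"
  using integrable_bounded_measurable[OF \<pi>_prob bounded_measurable_mult[OF assms assms]]
    measurable_of_prob_algebra[OF \<pi>_prob bounded_measurable_measurable[OF assms]]
  by (simp add: L2_funs_def power2_eq_square)

lemma L2_norm_eq_inner_prod: "L2_norm \<pi> f = sqrt (inner_prod f f)"
  by (simp add: L2_norm_def inner_prod_def power2_eq_square)

text \<open>The infimum \<open>z\<close> of the Rayleigh quotient of \<open>T\<close> over bounded functions cannot be negative. The form
  of \<open>S = T - z\<close> is positive semidefinite, and then the Cauchy-Schwarz inequality gives
  \<open>\<parallel>S g\<parallel>\<^sup>2 \<le> (1 - z) \<langle>g, S g\<rangle>\<close>. If \<open>z < 0\<close>, then \<open>z\<close> lies outside the spectrum and \<open>S\<close> has a bounded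
  inverse, so \<open>\<langle>g, S g\<rangle>\<close> is bounded below by a positive multiple of \<open>\<parallel>g\<parallel>\<^sup>2\<close>. This means that the
  Rayleigh quotient stays away from its infimum.\<close>
theorem inner_prod_T_nonneg:
  assumes spectrum: "nonneg_eigenvalues \<pi> P" and f: "f \<in> bounded_measurable M"
  shows "0 \<le> inner_prod f (T f)"
proof (rule ccontr)
  assume neg: "\<not> 0 \<le> inner_prod f (T f)"
  define Q where "Q = {inner_prod g (T g) |g. g \<in> bounded_measurable M \<and> inner_prod g g = 1}"
  define z where "z = Inf Q"
  have Q_bdd: "bdd_below Q"
  proof (rule bdd_belowI)
    show "- 1 \<le> r" if "r \<in> Q" for r
      using that abs_inner_prod_T_le unfolding Q_def by fastforce
  qed
  have scale: "inner_prod g (T g) / inner_prod g g \<in> Q" if g: "g \<in> bounded_measurable M" "0 < inner_prod g g" for g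
  proof -
    define c where "c = 1 / sqrt (inner_prod g g)"
    have c: "c\<^sup>2 = 1 / inner_prod g g" using g by (simp add: c_def power_divide)
    have "(\<lambda>x. c * g x) \<in> bounded_measurable M" using g by simp
    moreover have "inner_prod (\<lambda>x. c * g x) (\<lambda>x. c * g x) = 1" using g c by (simp add: inner_prod_cmult)
    moreover have "inner_prod (\<lambda>x. c * g x) (T (\<lambda>x. c * g x)) = inner_prod g (T g) / inner_prod g g"
      using c by (simp add: T_cmult inner_prod_cmult)
    ultimately show ?thesis unfolding Q_def by force
  qed
  have "0 < inner_prod f f" using neg abs_inner_prod_T_le[OF f] by linarith
  then have "z \<le> inner_prod f (T f) / inner_prod f f"
    unfolding z_def by (intro cInf_lower scale f Q_bdd)
  also have "\<dots> < 0" using neg \<open>0 < inner_prod f f\<close> by (simp add: divide_neg_pos)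
  finally have "z < 0" .
  have low: "0 \<le> inner_prod g (T g) + (- z) * inner_prod g g" if g: "g \<in> bounded_measurable M" for g
  proof (cases "inner_prod g g = 0")
    case True
    then show ?thesis using abs_inner_prod_T_le[OF g] by simp
  next
    case False
    then have pos: "0 < inner_prod g g" using inner_prod_nonneg[of g] by simp
    then have "z \<le> inner_prod g (T g) / inner_prod g g"
      unfolding z_def by (intro cInf_lower scale g Q_bdd)
    then show ?thesis using pos by (simp add: field_simps)
  qed
  define S where "S g = (\<lambda>x. T g x - z * g x)" for g
  have S_bm: "S g \<in> bounded_measurable M" if "g \<in> bounded_measurable M" for g
    using that unfolding S_def by (intro bounded_measurable_diff bounded_measurable_mult) auto
  have inner_prod_S: "inner_prod h (S g) = inner_prod h (T g) + (- z) * inner_prod h g"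
    if "g \<in> bounded_measurable M" "h \<in> bounded_measurable M" for g h
    using inner_prod_add_right[of h "T g" g "- z"] that by (simp add: S_def)
  have S_bound: "inner_prod (S g) (S g) \<le> (1 - z) * inner_prod g (S g)" if g: "g \<in> bounded_measurable M" for g
  proof -
    note Sg = S_bm[OF g]
    have "(inner_prod (S g) (S g))\<^sup>2 \<le> inner_prod (S g) (S (S g)) * inner_prod g (S g)"
      using inner_prod_T_Cauchy_Schwarz[OF low Sg g] by (simp only: inner_prod_S[OF g Sg] inner_prod_S[OF Sg Sg] inner_prod_S[OF g g])
    also have "\<dots> \<le> ((1 - z) * inner_prod (S g) (S g)) * inner_prod g (S g)"
    proof (rule mult_right_mono)
      show "inner_prod (S g) (S (S g)) \<le> (1 - z) * inner_prod (S g) (S g)"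
        using abs_inner_prod_T_le[OF Sg] by (simp add: inner_prod_S[OF Sg Sg] algebra_simps)
      show "0 \<le> inner_prod g (S g)" using low[OF g] by (simp only: inner_prod_S[OF g g])
    qed
    finally have "inner_prod (S g) (S g) * inner_prod (S g) (S g) \<le> inner_prod (S g) (S g) * ((1 - z) * inner_prod g (S g))"
      by (simp add: power2_eq_square algebra_simps)
    moreover have "0 \<le> (1 - z) * inner_prod g (S g)"
      using low[OF g] \<open>z < 0\<close> by (intro mult_nonneg_nonneg) (simp_all add: inner_prod_S[OF g g])
    ultimately show ?thesis
      using inner_prod_nonneg[of "S g"] by (cases "inner_prod (S g) (S g) = 0") (auto simp: mult_le_cancel_left)
  qed
  have "z \<notin> L2_spectrum \<pi> T"
    using spectrum \<open>z < 0\<close> by (auto simp: nonneg_eigenvalues_def)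
  then obtain R where R: "L2_inverse \<pi> (\<lambda>f x. T f x - z * f x) R"
    by (auto simp: L2_spectrum_def)
  then obtain c where c: "\<And>g. g \<in> L2_funs \<pi> \<Longrightarrow> L2_norm \<pi> (R g) \<le> c * L2_norm \<pi> g"
    by (auto simp: L2_inverse_def)
  have inverse_bound: "inner_prod g g \<le> c\<^sup>2 * inner_prod (S g) (S g)" if g: "g \<in> bounded_measurable M" for g
  proof -
    have R_Sg: "AE x in \<pi>. R (S g) x = g x" "R (S g) \<in> L2_funs \<pi>"
      using R bounded_measurable_L2_funs[OF g] bounded_measurable_L2_funs[OF S_bm[OF g]]
      by (auto simp: L2_inverse_def S_def)
    have "inner_prod (R (S g)) (R (S g)) = inner_prod g g"
      unfolding inner_prod_def
      using R_Sg measurable_of_prob_algebra[OF \<pi>_prob bounded_measurable_measurable[OF g]]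
      by (intro integral_cong_AE) (auto simp: L2_funs_def elim!: eventually_mono)
    then have "sqrt (inner_prod g g) \<le> c * sqrt (inner_prod (S g) (S g))"
      using c[OF bounded_measurable_L2_funs[OF S_bm[OF g]]] by (simp add: L2_norm_eq_inner_prod)
    then have "(sqrt (inner_prod g g))\<^sup>2 \<le> (c * sqrt (inner_prod (S g) (S g)))\<^sup>2"
      using inner_prod_nonneg by (intro power_mono) auto
    then show ?thesis using inner_prod_nonneg by (simp add: power_mult_distrib)
  qed
  define k where "k = c\<^sup>2 * (1 - z)"
  have gap: "1 \<le> k * (inner_prod g (T g) - z)" if g: "g \<in> bounded_measurable M" "inner_prod g g = 1" for g
  proof -
    have "1 \<le> c\<^sup>2 * inner_prod (S g) (S g)" using inverse_bound[OF g(1)] g(2) by simp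
    also have "\<dots> \<le> c\<^sup>2 * ((1 - z) * inner_prod g (S g))"
      using S_bound[OF g(1)] by (intro mult_left_mono) auto
    finally show ?thesis using g by (simp add: k_def inner_prod_S[OF g(1) g(1)] mult.assoc)
  qed
  have Q_ne: "Q \<noteq> {}" using scale[OF f \<open>0 < inner_prod f f\<close>] by blast
  then obtain g where g: "g \<in> bounded_measurable M" "inner_prod g g = 1" by (auto simp: Q_def)
  have "0 < k"
  proof -
    have "0 \<le> k" using \<open>z < 0\<close> by (simp add: k_def)
    moreover have "k \<noteq> 0" using gap[OF g] by auto
    ultimately show ?thesis by simp
  qed
  have "z + 1 / k \<le> Inf Q"
  proof (rule cInf_greatest[OF Q_ne])
    fix r assume "r \<in> Q"
    then show "z + 1 / k \<le> r"
      using gap \<open>0 < k\<close> by (auto simp: Q_def field_simps)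
  qed
  then show False using \<open>0 < k\<close> by (simp add: z_def)
qed

lemma inner_prod_T_power_symmetric:
  "f \<in> bounded_measurable M \<Longrightarrow> g \<in> bounded_measurable M \<Longrightarrow> inner_prod f ((T ^^ n) g) = inner_prod ((T ^^ n) f) g"
  by (induction n arbitrary: f) (simp_all add: inner_prod_T_symmetric flip: funpow_swap1)

lemma inner_prod_T_power_double:
  assumes "f \<in> bounded_measurable M"
  shows "inner_prod f ((T ^^ (2 * n)) f) = inner_prod ((T ^^ n) f) ((T ^^ n) f)"
  using inner_prod_T_power_symmetric[of f "(T ^^ n) f" n] assms by (simp add: mult_2 funpow_add)

text \<open>An even power gives a squared norm, an odd power the form of \<open>T\<close> at an iterate of \<open>f\<close>.\<close>
lemma inner_prod_T_power_nonneg: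
  assumes pos: "\<And>g. g \<in> bounded_measurable M \<Longrightarrow> 0 \<le> inner_prod g (T g)" and f: "f \<in> bounded_measurable M"
  shows "0 \<le> inner_prod f ((T ^^ n) f)"
proof (cases "even n")
  case True
  then show ?thesis using inner_prod_T_power_double[OF f] inner_prod_nonneg by (auto elim!: evenE)
next
  case False
  then obtain k where n: "n = 2 * k + 1" by (elim oddE)
  have "inner_prod f ((T ^^ n) f) = inner_prod ((T ^^ k) f) (T ((T ^^ k) f))"
    using inner_prod_T_power_symmetric[of f "T ((T ^^ k) f)" k] f
    by (simp add: n mult_2 funpow_add funpow_swap1)
  then show ?thesis using pos f by simp
qed

theorem inner_prod_T_power_decay:
  assumes pos: "\<And>g. g \<in> bounded_measurable M \<Longrightarrow> 0 \<le> inner_prod g (T g)" and f: "f \<in> bounded_measurable M"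
    and decay: "\<And>n. inner_prod f ((T ^^ n) f) \<le> c * \<rho> ^ n" and "0 < \<rho>"
  shows "inner_prod ((T ^^ n) f) ((T ^^ n) f) \<le> \<rho> ^ (2 * n) * inner_prod f f"
proof -
  have "inner_prod f ((T ^^ (2 * n)) f) \<le> \<rho> ^ (2 * n) * inner_prod f ((T ^^ 0) f)"
  proof (rule geometric_decay_of_doubling[OF inner_prod_T_power_nonneg[OF pos f] _ decay \<open>0 < \<rho>\<close>])
    show "(inner_prod f ((T ^^ n) f))\<^sup>2 \<le> inner_prod f ((T ^^ 0) f) * inner_prod f ((T ^^ (2 * n)) f)" for n
      using inner_prod_Cauchy_Schwarz[of f "(T ^^ n) f"] f by (simp add: inner_prod_T_power_double)
  qed
  then show ?thesis using f by (simp add: inner_prod_T_power_double)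
qed

end

section \<open>Geometric convergence of reversible regenerative chains\<close>

text \<open>The Radon-Nikodym derivative is at most \<open>c\<close> almost everywhere; cutting it off at \<open>c\<close> gives a version
  that is bounded at every point.\<close>
lemma bounded_density:
  assumes \<pi>: "\<pi> \<in> space (prob_algebra M)" and \<nu>: "\<nu> \<in> space (prob_algebra M)"
    and le: "\<And>S. S \<in> sets M \<Longrightarrow> measure \<nu> S \<le> c * measure \<pi> S"
  obtains f where "f \<in> bounded_measurable M" "\<And>x. f x \<le> c"
    "\<And>g. g \<in> bounded_measurable M \<Longrightarrow> (\<integral>x. g x \<partial>\<nu>) = (\<integral>x. f x * g x \<partial>\<pi>)"
proof -
  interpret pi: prob_space \<pi> using \<pi> by (simp add: space_prob_algebra)
  interpret nu: prob_space \<nu> using \<nu> by (simp add: space_prob_algebra)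
  note sets = sets_of_prob_algebra[OF \<pi>] sets_of_prob_algebra[OF \<nu>]
  have ac: "absolutely_continuous \<pi> \<nu>"
    unfolding absolutely_continuous_def
  proof
    fix S assume "S \<in> null_sets \<pi>"
    then have "S \<in> sets M" "measure \<pi> S = 0" using sets by (auto simp: null_sets_def measure_def)
    then have "measure \<nu> S = 0" using le[of S] by (simp add: measure_le_0_iff)
    then show "S \<in> null_sets \<nu>"
      using \<open>S \<in> sets M\<close> sets by (simp add: null_sets_def nu.emeasure_eq_measure)
  qed
  define D where "D x = enn2real (RN_deriv \<pi> \<nu> x)" for x
  have D_meas [measurable]: "D \<in> borel_measurable \<pi>" unfolding D_def by measurable
  have D_nonneg: "0 \<le> D x" for x by (simp add: D_def)
  have "AE x in \<pi>. RN_deriv \<pi> \<nu> x = ennreal (D x)"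
    using pi.RN_deriv_finite[OF nu.sigma_finite_measure_axioms ac] sets
    by (auto simp: D_def less_top elim!: eventually_mono)
  then have "density \<pi> (\<lambda>x. ennreal (D x)) = density \<pi> (RN_deriv \<pi> \<nu>)"
    by (intro density_cong) (auto elim: eventually_mono)
  also have "\<dots> = \<nu>" using ac sets by (intro pi.density_RN_deriv) auto
  finally have dens: "\<nu> = density \<pi> (\<lambda>x. ennreal (D x))" ..
  have int: "(\<integral>x. g x \<partial>\<nu>) = (\<integral>x. D x * g x \<partial>\<pi>)" "integrable \<pi> (\<lambda>x. D x * g x)"
    if g: "g \<in> bounded_measurable M" for g
  proof -
    have gm: "g \<in> borel_measurable \<pi>"
      by (rule measurable_of_prob_algebra[OF \<pi> bounded_measurable_measurable[OF g]])
    show "(\<integral>x. g x \<partial>\<nu>) = (\<integral>x. D x * g x \<partial>\<pi>)"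
      unfolding dens using integral_density[OF gm D_meas] D_nonneg by simp
    show "integrable \<pi> (\<lambda>x. D x * g x)"
      using integrable_bounded_measurable[OF \<nu> g] integrable_density[OF gm D_meas] D_nonneg
      unfolding dens by simp
  qed
  have D_int: "integrable \<pi> D" using int(2)[of "\<lambda>x. 1"] by simp
  have "AE x in \<pi>. 0 \<le> c - D x"
  proof (rule pi.density_nonneg)
    fix A assume A: "A \<in> sets \<pi>"
    then have A': "A \<in> sets M" using sets by simp
    have "measure \<nu> A = (\<integral>x. D x * indicator A x \<partial>\<pi>)"
      using int(1)[of "indicator A"] A' sets sets.sets_into_space[OF A', THEN Int_absorb2] space_of_prob_algebra[OF \<nu>] by simp
    then show "0 \<le> set_lebesgue_integral \<pi> A (\<lambda>x. c - D x)"
      using le[OF A'] A A' int(2)[of "indicator A"] integrable_bounded_measurable[OF \<pi> bounded_measurable_indicator[OF A']]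
      by (simp add: set_lebesgue_integral_def algebra_simps sets.Int_space_eq2)
  qed (use D_int in simp)
  then have D_le: "AE x in \<pi>. D x \<le> c" by (auto elim: eventually_mono)
  define f where "f x = min c (D x)" for x
  show ?thesis
  proof (rule that[of f])
    have "f \<in> borel_measurable M"
      using D_meas unfolding f_def measurable_cong_sets[OF sets(1) refl] by measurable
    moreover have "\<bar>f x\<bar> \<le> \<bar>c\<bar>" for x
      using D_nonneg[of x] by (auto simp: f_def min_def)
    ultimately show f_bm: "f \<in> bounded_measurable M" by (rule bounded_measurableI)
    show "f x \<le> c" for x by (simp add: f_def)
    show "(\<integral>x. g x \<partial>\<nu>) = (\<integral>x. f x * g x \<partial>\<pi>)" if g: "g \<in> bounded_measurable M" for g
    proof -
      have "(\<integral>x. D x * g x \<partial>\<pi>) = (\<integral>x. f x * g x \<partial>\<pi>)"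
        using D_le measurable_of_prob_algebra[OF \<pi> bounded_measurable_measurable[OF g]]
          D_meas measurable_of_prob_algebra[OF \<pi> bounded_measurable_measurable[OF f_bm]]
        by (intro integral_cong_AE) (auto simp: f_def elim!: eventually_mono)
      then show ?thesis using int(1)[OF g] by simp
    qed
  qed
qed

text \<open>Summation by parts in inductive form: for \<open>s t = (\<Sum>k\<le>t. a k * \<rho> ^ (t - k))\<close> one has
  \<open>s (t + 1) + q (t + 1) = \<rho> (s t + q t) + (1 - \<rho>) q t\<close>, and the last term adds at most
  \<open>(1 - \<rho>) A \<rho>\<^sup>t\<close> in each step.\<close>
lemma regeneration_sum_bound:
  fixes a q :: "nat \<Rightarrow> real"
  assumes q: "\<And>n. (\<Sum>k\<le>n. a k) = 1 - q n" "\<And>n. 0 \<le> q n" "\<And>n. q n \<le> A * \<rho> ^ n"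
    and \<rho>: "0 < \<rho>" "\<rho> < 1" and D: "0 \<le> D"
  shows "D * (\<Sum>k\<le>t. a k * \<rho> ^ (t - k)) + q t
    \<le> ((1 - \<rho>) / \<rho> * D * A * real t + max (1 - D) 0 * A + D) * \<rho> ^ t"
proof -
  define s where "s t = (\<Sum>k\<le>t. a k * \<rho> ^ (t - k))" for t
  have s: "s t + q t \<le> (1 + (1 - \<rho>) / \<rho> * A * real t) * \<rho> ^ t" for t
  proof (induction t)
    case 0
    then show ?case using q(1)[of 0] by (simp add: s_def)
  next
    case (Suc t)
    have "(\<Sum>k\<le>t. a k * \<rho> ^ (Suc t - k)) = \<rho> * s t"
      unfolding s_def sum_distrib_left by (intro sum.cong) (auto simp: Suc_diff_le)
    moreover have "a (Suc t) = q t - q (Suc t)" using q(1)[of t] q(1)[of "Suc t"] by simp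
    ultimately have "s (Suc t) + q (Suc t) = \<rho> * (s t + q t) + (1 - \<rho>) * q t"
      by (simp add: s_def[of "Suc t"] algebra_simps)
    also have "\<dots> \<le> \<rho> * ((1 + (1 - \<rho>) / \<rho> * A * real t) * \<rho> ^ t) + (1 - \<rho>) * (A * \<rho> ^ t)"
      using Suc q(3)[of t] \<rho> by (intro add_mono mult_left_mono) auto
    also have "\<dots> = (1 + (1 - \<rho>) / \<rho> * A * real (Suc t)) * \<rho> ^ Suc t"
      using \<rho> by (simp add: field_simps)
    finally show ?case .
  qed
  have "D * s t + q t = D * (s t + q t) + (1 - D) * q t" by (simp add: algebra_simps)
  also have "\<dots> \<le> D * ((1 + (1 - \<rho>) / \<rho> * A * real t) * \<rho> ^ t) + max (1 - D) 0 * (A * \<rho> ^ t)"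
  proof (rule add_mono)
    have "(1 - D) * q t \<le> max (1 - D) 0 * q t" using q(2) by (intro mult_right_mono) auto
    also have "\<dots> \<le> max (1 - D) 0 * (A * \<rho> ^ t)" using q(3) by (intro mult_left_mono) auto
    finally show "(1 - D) * q t \<le> max (1 - D) 0 * (A * \<rho> ^ t)" .
  qed (use s D in \<open>auto intro: mult_left_mono\<close>)
  also have "\<dots> = ((1 - \<rho>) / \<rho> * D * A * real t + max (1 - D) 0 * A + D) * \<rho> ^ t"
    by (simp add: algebra_simps)
  finally show ?thesis by (simp add: s_def)
qed

locale geometric_reversible_chain =
  minorized_chain M P C m \<epsilon> \<nu> + reversible_chain M P \<pi>
  for M :: "'a measure" and P C m \<epsilon> \<nu> \<pi> +
  fixes \<rho> a :: real and A :: "'a \<Rightarrow> real"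
  assumes positive: "f \<in> bounded_measurable M \<Longrightarrow> 0 \<le> inner_prod f (T f)"
    and \<rho>_pos: "0 < \<rho>" and \<rho>_less_1: "\<rho> < 1"
    and tail_le: "(\<integral>x. surv n (\<lambda>y. 1) x \<partial>\<nu>) \<le> a * \<rho> ^ n"
    and surv_le: "x \<in> space M \<Longrightarrow> surv n (\<lambda>y. 1) x \<le> A x * \<rho> ^ n"
begin

sublocale regenerative_chain M P C m \<epsilon> \<nu> \<pi>
proof
  show "\<pi> \<in> space (prob_algebra M)" by simp
  show "(\<integral>x. T f x \<partial>\<pi>) = (\<integral>x. f x \<partial>\<pi>)" if "f \<in> bounded_measurable M" for f
    by (rule integral_T_\<pi>[OF that])
  show "(\<lambda>n. surv n (\<lambda>y. 1) x) \<longlonglongrightarrow> 0" if x: "x \<in> space M" for x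
  proof (rule Lim_null_comparison)
    show "\<forall>\<^sub>F n in sequentially. norm (surv n (\<lambda>y. 1) x) \<le> A x * \<rho> ^ n"
      using surv_le[OF x] surv_nonneg[of "\<lambda>y. 1" x] x by simp
    show "(\<lambda>n. A x * \<rho> ^ n) \<longlonglongrightarrow> 0"
      using \<rho>_pos \<rho>_less_1 by (intro tendsto_mult_right_zero LIMSEQ_power_zero) simp
  qed
  show "summable (\<lambda>n. \<integral>x. surv n (\<lambda>y. 1) x \<partial>\<nu>)"
  proof (rule summable_comparison_test'[of "\<lambda>n. a * \<rho> ^ n"])
    show "summable (\<lambda>n. a * \<rho> ^ n)"
      using \<rho>_pos \<rho>_less_1 by (intro summable_mult summable_geometric) simp
    show "norm (\<integral>x. surv n (\<lambda>y. 1) x \<partial>\<nu>) \<le> a * \<rho> ^ n" for n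
      using tail_le[of n] integral_bounded_measurable_nonneg[OF \<nu>_prob surv_nonneg[OF bounded_measurable_const[of 1]]]
      by simp
  qed
qed

lemma summable_tail: "summable tail"
  using summable_surv_\<nu> by (simp add: tail_def[abs_def])

lemma geometric_tail_sum:
  assumes "\<And>k. g k \<le> b * \<rho> ^ k" "summable g"
  shows "(\<Sum>k. g (k + n)) \<le> b * \<rho> ^ n / (1 - \<rho>)"
proof -
  have "(\<lambda>k. b * \<rho> ^ n * \<rho> ^ k) sums (b * \<rho> ^ n * (1 / (1 - \<rho>)))"
    using \<rho>_pos \<rho>_less_1 by (intro sums_mult geometric_sums) simp
  moreover have "g (k + n) \<le> b * \<rho> ^ n * \<rho> ^ k" for k
    using assms(1)[of "k + n"] by (simp add: power_add mult.commute mult.left_commute)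
  ultimately show ?thesis
    using summable_ignore_initial_segment[OF assms(2), of n]
    by (intro sums_le[OF _ summable_sums, of "\<lambda>k. g (k + n)" "\<lambda>k. b * \<rho> ^ n * \<rho> ^ k"]) auto
qed

lemma mean_return_le: "mean_return \<le> 1 + a * \<rho> / (1 - \<rho>)"
proof -
  have "mean_return = (\<Sum>k. tail (k + 1)) + tail 0"
    using suminf_split_initial_segment[OF summable_tail, of 1] by (simp add: mean_return_def)
  also have "\<dots> \<le> a * \<rho> ^ 1 / (1 - \<rho>) + 1"
    using tail_le summable_tail by (intro add_mono geometric_tail_sum) (simp_all add: tail_0 flip: tail_def)
  finally show ?thesis by simp
qed

text \<open>The term \<open>n = 0\<close> of the cycle formula is the integral with respect to \<open>\<nu>\<close>.\<close>
lemma \<nu>_le_mean_return_\<pi>: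
  assumes S: "S \<in> sets M"
  shows "measure \<nu> S \<le> mean_return * measure \<pi> S"
proof -
  have bm: "indicator S \<in> bounded_measurable M" using S by simp
  have ind: "(\<integral>x. indicator S x \<partial>\<mu>) = measure \<mu> S" if "\<mu> \<in> space (prob_algebra M)" for \<mu>
    using S sets_of_prob_algebra[OF that] sets.sets_into_space[OF S] space_of_prob_algebra[OF that]
    by (simp add: Int_absorb2)
  have "(\<Sum>n<1. \<integral>y. surv n (indicator S) y \<partial>\<nu>) \<le> (\<Sum>n. \<integral>y. surv n (indicator S) y \<partial>\<nu>)"
    using cycle_formula[OF bm] integral_surv_nonneg[OF \<nu>_prob bm]
    by (intro sum_le_suminf) (auto simp: sums_iff)
  also have "\<dots> = mean_return * measure \<pi> S"
    using cycle_formula[OF bm] ind[OF \<pi>_prob] by (simp add: sums_iff)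
  finally show ?thesis using ind[OF \<nu>_prob] by simp
qed

text \<open>Half of the bound on the \<open>L\<^sup>2(\<pi>)\<close>-norm of the centred density of \<open>\<nu>\<close>.\<close>
definition D :: real where
  "D = 1 / 2 * sqrt (a * \<rho> / (1 - \<rho>))"

lemma a_nonneg: "0 \<le> a"
  using tail_le[of 0] tail_0 by (simp add: tail_def)

text \<open>With \<open>h\<close> the centred density of \<open>\<nu>\<close>, the difference to be estimated is \<open>\<langle>h, T\<^sup>n 1\<^sub>S\<rangle> = \<langle>T\<^sup>n h, 1\<^sub>S\<rangle>\<close>
  by symmetry. The norm of \<open>T\<^sup>n h\<close> comes from the decay of \<open>w n = \<langle>h, T\<^sup>n h\<rangle>\<close>: in the summed renewal
  equation for \<open>h\<close> all terms are nonnegative, and the right-hand side is the negative of a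
  geometrically small remainder because \<open>h\<close> has mean zero.\<close>
theorem convergence_from_\<nu>:
  assumes S: "S \<in> sets M"
  shows "\<bar>(\<integral>x. (T ^^ n) (indicator S) x \<partial>\<nu>) - measure \<pi> S\<bar> \<le> D * \<rho> ^ n"
proof -
  obtain f where f: "f \<in> bounded_measurable M" "\<And>x. f x \<le> mean_return"
    "\<And>g. g \<in> bounded_measurable M \<Longrightarrow> (\<integral>x. g x \<partial>\<nu>) = (\<integral>x. f x * g x \<partial>\<pi>)"
    using bounded_density[OF \<pi>_prob \<nu>_prob \<nu>_le_mean_return_\<pi>] by blast
  define h where "h x = f x - 1" for x
  have h: "h \<in> bounded_measurable M"
    unfolding h_def using f(1) by (intro bounded_measurable_diff) auto
  have inner_prod_h: "inner_prod h g = (\<integral>x. g x \<partial>\<nu>) - (\<integral>x. g x \<partial>\<pi>)" if g: "g \<in> bounded_measurable M" for g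
    using integrable_bounded_measurable[OF \<pi>_prob g] f(3)[OF g]
      integrable_bounded_measurable[OF \<pi>_prob bounded_measurable_mult[OF f(1) g]]
    by (simp add: inner_prod_def h_def left_diff_distrib)
  have h_mean: "(\<integral>x. h x \<partial>\<pi>) = 0"
    using inner_prod_h[OF bounded_measurable_const[of 1]] measure_space_prob_algebra[OF \<nu>_prob]
      measure_space_prob_algebra[OF \<pi>_prob] by (simp add: inner_prod_def)
  define w where "w n = inner_prod h ((T ^^ n) h)" for n
  have w: "w n = (\<integral>x. (T ^^ n) h x \<partial>\<nu>)" for n
    using inner_prod_h[of "(T ^^ n) h"] h h_mean by (simp add: w_def integral_T_power_\<pi>)
  have w_nonneg: "0 \<le> w n" for n
    unfolding w_def by (rule inner_prod_T_power_nonneg[OF positive h])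
  have w0_le: "w 0 \<le> a * \<rho> / (1 - \<rho>)"
  proof -
    interpret nu: prob_space \<nu> using \<nu>_prob by (simp add: space_prob_algebra)
    have "(\<integral>x. h x \<partial>\<nu>) \<le> (\<integral>x. mean_return - 1 \<partial>\<nu>)"
      by (rule integral_mono_bounded_measurable[OF \<nu>_prob h bounded_measurable_const]) (simp add: h_def f(2))
    then show ?thesis using mean_return_le by (simp add: w nu.prob_space)
  qed
  obtain c where c: "0 \<le> c" "\<forall>y\<in>space M. \<bar>h y\<bar> \<le> c" using bounded_measurable_bound[OF h] by blast
  define g where "g n = (\<integral>y. surv n h y \<partial>\<nu>)" for n
  have g_sums: "g sums 0"
    using cycle_formula[OF h] h_mean by (simp add: g_def[abs_def])
  have g_le: "- g n \<le> (c * a) * \<rho> ^ n" for n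
  proof -
    have "\<bar>g n\<bar> \<le> c * tail n"
      using abs_integral_surv_le[OF \<nu>_prob h] c by (simp add: g_def tail_def)
    also have "\<dots> \<le> c * (a * \<rho> ^ n)"
      using tail_le c by (intro mult_left_mono) (simp_all add: tail_def)
    finally show ?thesis by simp
  qed
  have w_decay: "w n \<le> (c * a * \<rho> / (1 - \<rho>)) * \<rho> ^ n" for n
  proof -
    \<comment> \<open>Keep only the term \<open>k = 0\<close>, where the tail of the regeneration time is \<open>1\<close>.\<close>
    have "tail 0 * w (n - 0) \<le> (\<Sum>k\<le>n. tail k * w (n - k))"
      using tail_nonneg w_nonneg by (intro member_le_sum) auto
    then have "w n \<le> (\<Sum>k\<le>n. g k)"
      using renewal_equation_sum[OF h, of n] by (simp add: tail_0 w g_def)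
    also have "\<dots> = (\<Sum>k. - g (k + Suc n))"
      using suminf_split_initial_segment[of g "Suc n"] g_sums
        summable_ignore_initial_segment[of g "Suc n"]
      by (simp add: sums_iff suminf_minus lessThan_Suc_atMost)
    also have "\<dots> \<le> (c * a) * \<rho> ^ Suc n / (1 - \<rho>)"
      using g_le g_sums by (intro geometric_tail_sum) (auto simp: sums_iff summable_minus)
    finally show ?thesis by (simp add: mult.commute mult.left_commute)
  qed
  define u where "u = (T ^^ n) h"
  have u: "u \<in> bounded_measurable M" using h by (simp add: u_def)
  have u_mean: "(\<integral>x. u x \<partial>\<pi>) = 0" using h h_mean by (simp add: u_def integral_T_power_\<pi>)
  have "inner_prod u u \<le> \<rho> ^ (2 * n) * w 0"
    using inner_prod_T_power_decay[OF positive h w_decay[unfolded w_def] \<rho>_pos] by (simp add: w_def u_def)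
  also have "\<dots> \<le> \<rho> ^ (2 * n) * (a * \<rho> / (1 - \<rho>))"
    using w0_le \<rho>_pos by (intro mult_left_mono) auto
  finally have inner_prod_u: "inner_prod u u \<le> \<rho> ^ (2 * n) * (a * \<rho> / (1 - \<rho>))" .
  have ind: "indicator S \<in> bounded_measurable M" using S by simp
  \<comment> \<open>As \<open>u\<close> has mean zero, subtracting \<open>1/2\<close> from the indicator of \<open>S\<close> does not change the inner
    product; it gives a function of constant modulus \<open>1/2\<close>, the factor in \<open>D\<close>.\<close>
  define e where "e x = indicator S x - (1 / 2 :: real)" for x
  have e: "e \<in> bounded_measurable M"
    unfolding e_def using ind by (intro bounded_measurable_diff) auto
  have "(\<integral>x. (T ^^ n) (indicator S) x \<partial>\<nu>) - measure \<pi> S = inner_prod h ((T ^^ n) (indicator S))"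
    using inner_prod_h[of "(T ^^ n) (indicator S)"] ind S sets_of_prob_algebra[OF \<pi>_prob]
      sets.sets_into_space[OF S] space_of_prob_algebra[OF \<pi>_prob]
    by (simp add: integral_T_power_\<pi> Int_absorb2)
  also have "\<dots> = inner_prod u (indicator S)"
    unfolding u_def by (rule inner_prod_T_power_symmetric[OF h ind])
  also have "\<dots> = inner_prod u e"
    using integrable_bounded_measurable[OF \<pi>_prob bounded_measurable_mult[OF u ind]]
      integrable_bounded_measurable[OF \<pi>_prob u] u_mean
    by (simp add: inner_prod_def e_def right_diff_distrib)
  finally have eq: "(\<integral>x. (T ^^ n) (indicator S) x \<partial>\<nu>) - measure \<pi> S = inner_prod u e" .
  have inner_prod_e: "inner_prod e e = 1 / 4"
  proof -
    have "(\<lambda>x. e x * e x) = (\<lambda>x. 1 / 4)" by (simp add: e_def indicator_def fun_eq_iff)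
    then show ?thesis using measure_space_prob_algebra[OF \<pi>_prob] by (simp add: inner_prod_def)
  qed
  have "(inner_prod u e)\<^sup>2 \<le> inner_prod u u * (1 / 4)"
    using inner_prod_Cauchy_Schwarz[OF u e] unfolding inner_prod_e .
  also have "\<dots> \<le> \<rho> ^ (2 * n) * (a * \<rho> / (1 - \<rho>)) * (1 / 4)"
    by (intro mult_right_mono inner_prod_u) simp
  also have "\<dots> = (D * \<rho> ^ n)\<^sup>2"
    using a_nonneg \<rho>_pos \<rho>_less_1
    by (simp add: D_def power_mult_distrib power_divide power_mult mult.commute)
  finally have "\<bar>inner_prod u e\<bar> \<le> \<bar>D * \<rho> ^ n\<bar>"
    by (simp only: abs_le_square_iff)
  moreover have "0 \<le> D * \<rho> ^ n"
    using a_nonneg \<rho>_pos \<rho>_less_1 by (simp add: D_def)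
  ultimately show ?thesis unfolding eq by simp
qed

text \<open>Subtract \<open>\<pi>(S)\<close> from the renewal decomposition, distributing it over the probabilities of \<open>\<tau> = k\<close>
  and of \<open>\<tau> > t\<close>. Each regenerated part is controlled by the convergence from \<open>\<nu>\<close>, and the part
  without regeneration by its mass.\<close>
theorem convergence_rate:
  assumes x: "x \<in> space M" and S: "S \<in> sets M"
  shows "\<bar>(T ^^ t) (indicator S) x - measure \<pi> S\<bar>
    \<le> ((1 - \<rho>) / \<rho> * D * A x * real t + max (1 - D) 0 * A x + D) * \<rho> ^ t"
proof -
  interpret pi: prob_space \<pi> using \<pi>_prob by (simp add: space_prob_algebra)
  have ind: "indicator S \<in> bounded_measurable M" using S by simp
  define p where "p = measure \<pi> S"
  define v where "v n = (\<integral>y. (T ^^ n) (indicator S) y \<partial>\<nu>)" for n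
  define q where "q n = surv n (\<lambda>y. 1) x" for n
  have sum: "(\<Sum>k\<le>n. regen k x) = 1 - q n" for n
    using sum_regen[OF x] by (simp add: q_def)
  have surv: "0 \<le> surv t (indicator S) x" "surv t (indicator S) x \<le> q t"
    using surv_nonneg[OF ind] surv_mono[OF ind bounded_measurable_const[of 1]] x
    by (auto simp: q_def indicator_def)
  have p: "0 \<le> p" "p \<le> 1" by (auto simp: p_def)
  have q: "0 \<le> q n" for n unfolding q_def by (rule surv_nonneg) (use x in auto)
  have "(T ^^ t) (indicator S) x - p =
      (\<Sum>k\<le>t. regen k x * (v (t - k) - p)) + (surv t (indicator S) x - q t * p)"
    using renewal_decomposition[OF ind x, of t] sum[of t]
    by (simp add: v_def[abs_def] right_diff_distrib sum_subtractf flip: sum_distrib_right)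
      (simp add: algebra_simps)
  also have "\<bar>\<dots>\<bar> \<le> (\<Sum>k\<le>t. \<bar>regen k x * (v (t - k) - p)\<bar>) + \<bar>surv t (indicator S) x - q t * p\<bar>"
    by (intro order_trans[OF abs_triangle_ineq] add_right_mono sum_abs)
  also have "\<dots> \<le> (\<Sum>k\<le>t. regen k x * (D * \<rho> ^ (t - k))) + q t"
  proof (intro add_mono sum_mono)
    show "\<bar>regen k x * (v (t - k) - p)\<bar> \<le> regen k x * (D * \<rho> ^ (t - k))" for k
      using regen_nonneg[OF x, of k] convergence_from_\<nu>[OF S, of "t - k"]
      by (simp add: abs_mult v_def p_def mult_left_mono)
    have "0 \<le> q t * p" "q t * p \<le> q t" using p q[of t] by (simp_all add: mult_left_le)
    then show "\<bar>surv t (indicator S) x - q t * p\<bar> \<le> q t" using surv by linarith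
  qed
  also have "\<dots> = D * (\<Sum>k\<le>t. regen k x * \<rho> ^ (t - k)) + q t"
    by (simp add: sum_distrib_left mult.left_commute)
  also have "\<dots> \<le> ((1 - \<rho>) / \<rho> * D * A x * real t + max (1 - D) 0 * A x + D) * \<rho> ^ t"
  proof (rule regeneration_sum_bound[OF sum q _ \<rho>_pos \<rho>_less_1])
    show "q n \<le> A x * \<rho> ^ n" for n using surv_le[OF x] by (simp add: q_def)
    show "0 \<le> D" using a_nonneg \<rho>_pos \<rho>_less_1 by (simp add: D_def)
  qed
  finally show ?thesis by (simp add: p_def)
qed

end

section \<open>The explicit rate\<close>

context drift_chain begin

text \<open>If \<open>\<epsilon> < 1\<close>, Jensen's inequality bounds the left-hand side by
  \<open>(1 - \<epsilon>) powr (1 - r) * (B - \<epsilon>) powr r\<close>, where \<open>B\<close> is the drift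
  bound. The hypothesis on \<open>r\<close> is the logarithmic form of the statement that this is at most
  \<open>(l powr r) ^ m\<close>.\<close>
lemma residual_rate:
  assumes x: "x \<in> C" and r: "0 \<le> r" "r \<le> 1"
    and rate: "\<epsilon> < 1 \<Longrightarrow>
      r * (- real m * ln l + ln (drift_bound - \<epsilon>) - ln (1 - \<epsilon>)) \<le> - ln (1 - \<epsilon>)"
  shows "residual x (\<lambda>y. V y powr r) \<le> (l powr r) ^ m"
proof (cases "\<epsilon> = 1")
  case True
  then show ?thesis using residual_eq_0[OF True x] by simp
next
  case False
  then have \<epsilon>: "\<epsilon> < 1" using \<epsilon>_le_1 by simp
  define c where "c = (drift_bound - \<epsilon>) / (1 - \<epsilon>)"
  have pos: "0 < 1 - \<epsilon>" "0 < drift_bound - \<epsilon>" using \<epsilon> drift_bound_ge_1 by auto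
  then have c: "0 < c" by (simp add: c_def)
  have "residual x (\<lambda>y. V y powr r) \<le> (1 - \<epsilon>) * c powr r"
  proof (rule residual_powr_le[OF x V_measurable])
    show "residual x V \<le> (1 - \<epsilon>) * c" using residual_V_le[OF x] pos by (simp add: c_def)
  qed (use integral_V_inside[OF x] integrable_V_\<nu> V_ge_1 r c in auto)
  also have "\<dots> = exp (ln (1 - \<epsilon>) + r * (ln (drift_bound - \<epsilon>) - ln (1 - \<epsilon>)))"
    using pos c by (simp add: powr_def exp_add c_def ln_div)
  also have "\<dots> \<le> exp (real m * (r * ln l))"
    using rate[OF \<epsilon>] by (simp add: algebra_simps)
  also have "\<dots> = (l powr r) ^ m"
    using l_pos by (simp add: powr_def exp_of_nat_mult)
  finally show ?thesis .
qed

lemma surv_one_le_drift: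
  assumes r: "0 \<le> r" "r \<le> 1" and x: "x \<in> space M"
    and rate: "\<epsilon> < 1 \<Longrightarrow>
      r * (- real m * ln l + ln (drift_bound - \<epsilon>) - ln (1 - \<epsilon>)) \<le> - ln (1 - \<epsilon>)"
  shows "surv n (\<lambda>y. 1) x \<le> V x powr r * (l powr r) powi (1 - int m) * (l powr r) ^ n"
proof (rule surv_one_le_of_contraction[OF _ _ _ _ _ _ _ _ _ x])
  have AE: "AE y in \<mu>. 1 \<le> V y" if "\<mu> \<in> space (prob_algebra M)" for \<mu>
    using V_ge_1 space_of_prob_algebra[OF that] by auto
  show "(\<lambda>y. V y powr r) \<in> borel_measurable M" by measurable
  show "1 \<le> V y powr r" if "y \<in> space M" for y
    using V_ge_1[OF that] r by (simp add: ge_one_powr_ge_zero)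
  show "0 < l powr r" using l_pos by simp
  show "l powr r \<le> 1" using l_pos l_less_1 r by (simp add: powr_le1)
  show "integrable (P y) (\<lambda>y. V y powr r)" if "y \<in> space M" "y \<notin> C" for y
    using integral_V_outside[OF that] AE[OF kernel_prob[OF that(1)]] r by (intro integrable_powr)
  show "T (\<lambda>y. V y powr r) y \<le> l powr r * V y powr r" if y: "y \<in> space M" "y \<notin> C" for y
  proof -
    have "(\<integral>z. V z powr r \<partial>P y) \<le> (l * V y) powr r"
      using integral_V_outside[OF y] V_ge_1 V_ge_1[OF y(1)] r l_pos
      by (intro integral_powr_le[OF kernel_prob[OF y(1)]]) auto
    then show ?thesis using l_pos V_nonneg[OF y(1)] by (simp add: kernel_op_def powr_mult)
  qed
  show "integrable (kernel_power M P m y) (\<lambda>y. V y powr r)" if "y \<in> C" for y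
    using integral_V_inside[OF that] AE[OF kernel_power_prob[OF C_space[OF that]]] r by (intro integrable_powr)
  show "integrable \<nu> (\<lambda>y. V y powr r)"
    using integrable_V_\<nu> AE[OF \<nu>_prob] r by (intro integrable_powr)
  show "residual y (\<lambda>y. V y powr r) \<le> (l powr r) ^ m" if "y \<in> C" for y
    by (rule residual_rate[OF that r rate])
qed

lemma integral_surv_one_le_drift:
  assumes r: "0 \<le> r" "r \<le> 1"
    and rate: "\<epsilon> < 1 \<Longrightarrow>
      r * (- real m * ln l + ln (drift_bound - \<epsilon>) - ln (1 - \<epsilon>)) \<le> - ln (1 - \<epsilon>)"
  shows "(\<integral>x. surv n (\<lambda>y. 1) x \<partial>\<nu>)
    \<le> ((drift_bound - (1 - \<epsilon>)) / \<epsilon>) powr r * (l powr r) powi (1 - int m) * (l powr r) ^ n"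
proof -
  define b where "b = (l powr r) powi (1 - int m) * (l powr r) ^ n"
  have b: "0 \<le> b" by (simp add: b_def)
  have AE: "AE y in \<nu>. 1 \<le> V y" using V_ge_1 space_of_prob_algebra[OF \<nu>_prob] by auto
  have "(\<integral>x. surv n (\<lambda>y. 1) x \<partial>\<nu>) \<le> (\<integral>x. V x powr r * b \<partial>\<nu>)"
    using surv_one_le_drift[OF r _ rate] integrable_powr[OF integrable_V_\<nu> AE r]
      space_of_prob_algebra[OF \<nu>_prob]
      integrable_bounded_measurable[OF \<nu>_prob surv_bounded_measurable[OF bounded_measurable_const[of 1]]]
    by (intro integral_mono) (auto simp: b_def mult.assoc)
  also have "\<dots> = (\<integral>x. V x powr r \<partial>\<nu>) * b" by simp
  also have "\<dots> \<le> ((drift_bound - (1 - \<epsilon>)) / \<epsilon>) powr r * b"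
    using integral_powr_le[OF \<nu>_prob integrable_V_\<nu> V_ge_1 r _ integral_V_\<nu>_le] \<epsilon>_pos drift_bound_ge_1 b
    by (intro mult_right_mono) auto
  finally show ?thesis by (simp add: b_def mult.assoc)
qed

end

theorem theorem1p8:
  fixes M :: "'a measure" and P :: "'a \<Rightarrow> 'a measure" and \<pi> \<nu> :: "'a measure"
    and C :: "'a set" and V :: "'a \<Rightarrow> real" and l K \<epsilon> :: real and m :: nat
    and B \<rho> r A\<^sub>\<nu> D :: real and A :: "'a \<Rightarrow> real" and F :: "'a \<Rightarrow> nat \<Rightarrow> real"
  assumes kernel: "markov_kernel M P"
    and prob: "\<pi> \<in> space (prob_algebra M)"
    and rev: "reversible M \<pi> P"
    and nonneg: "nonneg_eigenvalues \<pi> P"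
    and drift: "drift_function M P C V l K"
    and small: "small_set M P C m \<epsilon> \<nu>"
    and B: "B = (1 - l ^ m) / (1 - l) * (K - l) + l ^ m"
    and \<rho>: "\<rho> = (if \<epsilon> = 1 then l
                  else max l (exp (- ln (1 - \<epsilon>) * ln l /
                                   (- real m * ln l + ln (B - \<epsilon>) - ln (1 - \<epsilon>)))))"
    and r: "r = (if \<epsilon> = 1 then 1 else ln \<rho> / ln l)"
    and A\<^sub>\<nu>: "A\<^sub>\<nu> = ((B - (1 - \<epsilon>)) / \<epsilon>) powr r * \<rho> powi (1 - int m)"
    and A: "\<And>x. A x = V x powr r * \<rho> powi (1 - int m)"
    and D: "D = 1 / 2 * sqrt (A\<^sub>\<nu> * \<rho> / (1 - \<rho>))"
    and F: "\<And>x t. F x t = (1 - \<rho>) / \<rho> * D * A x * real t + max (1 - D) 0 * A x + D"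
  shows "\<rho> < 1 \<and> (\<forall>x\<in>space M. \<forall>t. tv_dist M (kernel_power M P t x) \<pi> \<le> F x t * \<rho> ^ t)"
proof -
  interpret pi: prob_space \<pi> using prob by (simp add: space_prob_algebra)
  interpret drift_chain M P C m \<epsilon> \<nu> V l K
  proof
    show "P \<in> M \<rightarrow>\<^sub>M prob_algebra M" using kernel by (simp add: markov_kernel_def)
    show "space M \<noteq> {}" using pi.not_empty space_of_prob_algebra[OF prob] by simp
  qed (fact drift small)+
  interpret rev: reversible_chain M P \<pi>
    by unfold_locales (fact prob rev)+
  have B_eq: "B = drift_bound" by (simp add: B drift_bound_def)
  have B_ge: "1 \<le> B" using drift_bound_ge_1 by (simp add: B_eq)
  have ln_l: "ln l < 0" using l_pos l_less_1 by simp
  define den where "den = - real m * ln l + ln (B - \<epsilon>) - ln (1 - \<epsilon>)"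
  \<comment> \<open>Dividing logarithms by \<open>ln l < 0\<close> turns the maximum that defines \<open>\<rho>\<close> into the minimum of two
    exponents: \<open>1\<close>, the limit for Jensen's inequality, and the largest \<open>r\<close> allowed in a block.\<close>
  have rate: "0 < \<rho> \<and> \<rho> < 1 \<and> 0 \<le> r \<and> r \<le> 1 \<and> \<rho> = l powr r \<and> (\<epsilon> < 1 \<longrightarrow> r * den \<le> - ln (1 - \<epsilon>))"
  proof (cases "\<epsilon> = 1")
    case True
    then show ?thesis using \<rho> r l_pos l_less_1 by simp
  next
    case False
    then have \<epsilon>: "\<epsilon> < 1" using \<epsilon>_le_1 by simp
    then have ln_\<epsilon>: "ln (1 - \<epsilon>) < 0" using \<epsilon>_pos by simp
    have "0 < - real m * ln l" using m_pos ln_l by (simp add: mult_pos_neg)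
    moreover have "ln (1 - \<epsilon>) \<le> ln (B - \<epsilon>)" using \<epsilon> B_ge by simp
    ultimately have den: "0 < den" by (simp add: den_def)
    define e where "e = - ln (1 - \<epsilon>) * ln l / den"
    have e: "e < 0" using ln_\<epsilon> ln_l den by (simp add: e_def divide_neg_pos mult_neg_neg)
    have \<rho>': "\<rho> = max l (exp e)" using False \<rho> by (simp add: e_def den_def)
    then have \<rho>_bounds: "0 < \<rho>" "\<rho> < 1" "l \<le> \<rho>" "exp e \<le> \<rho>" using l_pos l_less_1 e by auto
    then have ln_\<rho>: "ln \<rho> < 0" "ln l \<le> ln \<rho>" "e \<le> ln \<rho>"
      using l_pos by (auto simp: ln_ge_iff)
    have r': "r = ln \<rho> / ln l" using False r by simp
    have "\<rho> = l powr r" using r' ln_l l_pos \<rho>_bounds by (simp add: powr_def)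
    moreover have "0 \<le> r" "r \<le> 1" using r' ln_l ln_\<rho> by (simp_all add: divide_nonpos_neg divide_le_eq)
    moreover have "r * den \<le> - ln (1 - \<epsilon>)"
    proof -
      have "e * den \<le> ln \<rho> * den" using ln_\<rho>(3) den by (intro mult_right_mono) auto
      moreover have "e * den = - ln (1 - \<epsilon>) * ln l" using den by (simp add: e_def)
      ultimately show ?thesis using ln_l by (simp add: r' divide_le_eq)
    qed
    ultimately show ?thesis using \<rho>_bounds by simp
  qed
  then have rate': "\<epsilon> < 1 \<Longrightarrow>
      r * (- real m * ln l + ln (drift_bound - \<epsilon>) - ln (1 - \<epsilon>)) \<le> - ln (1 - \<epsilon>)"
    by (simp add: den_def B_eq)
  have \<rho>_eq: "\<rho> = l powr r" using rate by simp
  interpret geo: geometric_reversible_chain M P C m \<epsilon> \<nu> \<pi> \<rho> A\<^sub>\<nu> A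
  proof
    show "0 \<le> rev.inner_prod f (T f)" if "f \<in> bounded_measurable M" for f
      by (rule rev.inner_prod_T_nonneg[OF nonneg that])
    show "(\<integral>x. surv n (\<lambda>y. 1) x \<partial>\<nu>) \<le> A\<^sub>\<nu> * \<rho> ^ n" for n
      using integral_surv_one_le_drift[of r n] rate rate' by (simp add: A\<^sub>\<nu> B_eq)
    show "surv n (\<lambda>y. 1) x \<le> A x * \<rho> ^ n" if "x \<in> space M" for x n
      using surv_one_le_drift[of r x n] that rate rate' by (simp add: A)
  qed (use rate in auto)
  have "tv_dist M (kernel_power M P t x) \<pi> \<le> F x t * \<rho> ^ t" if x: "x \<in> space M" for x t
    unfolding tv_dist_def
  proof (rule cSUP_least)
    fix S assume S: "S \<in> sets M"
    have "measure (kernel_power M P t x) S = (T ^^ t) (indicator S) x"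
      using integral_kernel_power[OF x bounded_measurable_indicator[OF S], of t] S
        sets_of_prob_algebra[OF kernel_power_prob[OF x]] sets.sets_into_space[OF S]
        space_of_prob_algebra[OF kernel_power_prob[OF x]]
      by (simp add: Int_absorb2)
    then show "\<bar>measure (kernel_power M P t x) S - measure \<pi> S\<bar> \<le> F x t * \<rho> ^ t"
      using geo.convergence_rate[OF x S, of t] by (simp add: F geo.D_def D)
  qed auto
  then show ?thesis using rate by simp
qed

end
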